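(* Let $X$ be a separable complex hereditarily indecomposable Banach space. Then there is no bounded $\mathfrak{u}$-frequently hypercyclic linear operator on $X$. In particular, there is no frequently hypercyclic bounded linear operator on $X$.
   Context: An infinite dimensional Banach space $X$ is called hereditarily indecomposable (an HI space) if for any infinite dimensional closed linear subspaces $L$ and $M$ of $X$ satisfying $L\cap M=\{0\}$, their sum $L+M$ is not closed. For $A\subseteq\mathbb{Z}_+$ (non-negative integers), $\underline{d}(A)=\liminf_{n\to\infty}\frac{|\{m\in A:m\leq n\}|}{n}$ is the lower density and $\overline{d}(A)=\limsup_{n\to\infty}\frac{|\{m\in A:m\leq n\}|}{n}$ is the upper density. A continuous linear operator $T$ on a topological vector space $X$ is frequently hypercyclic (respectively $\mathfrak{u}$-frequently hypercyclic) if there is $x\in X$ such that for every non-empty open $U\subseteq X$ the set $\{n\in\mathbb{N}:T^nx\in U\}$ has positive lower (respectively positive upper) density ($\mathbb{N}$ is the set of positive integers). *)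

theory Defs
  imports "HOL-Analysis.Analysis"
begin

text \<open>Complex Banach spaces, as real Banach spaces with a compatible complex scalar
  multiplication.\<close>

class complex_vector = real_vector +
  fixes scaleC :: "complex \<Rightarrow> 'a \<Rightarrow> 'a"  (infixr \<open>*\<^sub>C\<close> 75)
  assumes scaleC_add_right: "a *\<^sub>C (x + y) = a *\<^sub>C x + a *\<^sub>C y"
    and scaleC_add_left: "(a + b) *\<^sub>C x = a *\<^sub>C x + b *\<^sub>C x"
    and scaleC_scaleC: "a *\<^sub>C (b *\<^sub>C x) = (a * b) *\<^sub>C x"
    and scaleC_one: "1 *\<^sub>C x = x"
    and scaleC_of_real: "complex_of_real r *\<^sub>C x = r *\<^sub>R x"

class complex_normed_vector = complex_vector + real_normed_vector +
  assumes norm_scaleC: "norm (a *\<^sub>C x) = cmod a * norm x"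

class complex_banach = complex_normed_vector + banach

global_interpretation complex_vector:
  vector_space "scaleC :: complex \<Rightarrow> 'a \<Rightarrow> 'a::complex_vector"
  by unfold_locales (rule scaleC_add_right scaleC_add_left scaleC_scaleC scaleC_one)+

instantiation complex :: complex_banach
begin

definition scaleC_complex :: "complex \<Rightarrow> complex \<Rightarrow> complex"
  where "scaleC_complex a x = a * x"

instance
  by standard
    (simp_all add: scaleC_complex_def algebra_simps norm_mult scaleR_conv_of_real)

end

definition bounded_clinear ::
    "('a::complex_normed_vector \<Rightarrow> 'b::complex_normed_vector) \<Rightarrow> bool"
  where "bounded_clinear T \<longleftrightarrow> Vector_Spaces.linear scaleC scaleC T \<and>
    (\<exists>K. \<forall>x. norm (T x) \<le> K * norm x)"

definition infinite_dimensional :: "'a::complex_vector set \<Rightarrow> bool"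
  where "infinite_dimensional L \<longleftrightarrow> (\<nexists>B. finite B \<and> complex_vector.span B = L)"

definition hereditarily_indecomposable :: "'a::complex_banach itself \<Rightarrow> bool"
  where "hereditarily_indecomposable _ \<longleftrightarrow>
    infinite_dimensional (UNIV :: 'a set) \<and>
    (\<forall>L M :: 'a set.
       complex_vector.subspace L \<and> closed L \<and> infinite_dimensional L \<and>
       complex_vector.subspace M \<and> closed M \<and> infinite_dimensional M \<and>
       L \<inter> M = {0} \<longrightarrow>
       \<not> closed {x + y |x y. x \<in> L \<and> y \<in> M})"

text \<open>The value of the quotients at \<open>n = 0\<close>, where division by zero gives \<open>0\<close>, does not
  affect the limits.\<close>

definition lower_density :: "nat set \<Rightarrow> ereal"
  where "lower_density A = liminf (\<lambda>n. ereal (real (card {m \<in> A. m \<le> n}) / real n))"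

definition upper_density :: "nat set \<Rightarrow> ereal"
  where "upper_density A = limsup (\<lambda>n. ereal (real (card {m \<in> A. m \<le> n}) / real n))"

text \<open>The next two notions concern the orbits only; linearity and continuity of \<open>T\<close> are
  to be assumed separately.\<close>

definition frequently_hypercyclic :: "('a::topological_space \<Rightarrow> 'a) \<Rightarrow> bool"
  where "frequently_hypercyclic T \<longleftrightarrow>
    (\<exists>x. \<forall>U. open U \<and> U \<noteq> {} \<longrightarrow> lower_density {n. n > 0 \<and> (T ^^ n) x \<in> U} > 0)"

definition u_frequently_hypercyclic :: "('a::topological_space \<Rightarrow> 'a) \<Rightarrow> bool"
  where "u_frequently_hypercyclic T \<longleftrightarrow>
    (\<exists>x. \<forall>U. open U \<and> U \<noteq> {} \<longrightarrow> upper_density {n. n > 0 \<and> (T ^^ n) x \<in> U} > 0)"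

end

theory Submission
  imports Defs "HOL-Complex_Analysis.Complex_Analysis"
begin

text \<open>
A u-frequently hypercyclic operator \<open>T\<close> has a dense orbit, so its dual has no eigenvectors
(\<open>dense_orbit_no_dual_eigenvector\<close>). The proof shows that on a hereditarily indecomposable
space this forces the spectrum of \<open>T\<close> into a single point \<open>\<alpha>\<close>, and that an operator with such a
spectrum has a non-empty open set that every orbit visits with upper density zero.

\<^bold>\<open>The spectrum.\<close> Call an operator \<open>S\<close> infinitely singular if it is not bounded below on any
subspace of finite codimension. If \<open>T - \<alpha>\<close> is not infinitely singular, then it is open onto its
range, which is closed; its range is dense because the dual has no eigenvectors, so \<open>T - \<alpha>\<close> is
onto. At the boundary of the spectrum this cannot happen: the norm bounds on preimages would carry
over to the resolvents at nearby points, and then extend the resolvent to \<open>\<alpha>\<close> itself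
(\<open>open_onto_in_closure_resolvent\<close>). So \<open>T - \<alpha>\<close> is infinitely
singular at every frontier point \<open>\<alpha>\<close> of the spectrum. An infinitely singular operator is
arbitrarily small on some closed infinite-dimensional subspace
(\<open>infinitely_singular_small_subspace\<close>). If \<open>T - \<alpha>\<close> is small on \<open>Y\<close> and \<open>T - \<beta>\<close> is small on \<open>Z\<close>
with \<open>\<alpha> \<noteq> \<beta>\<close>, then \<open>T\<close> nearly acts by different scalars on \<open>Y\<close> and \<open>Z\<close>, so their unit spheres
have positive distance and \<open>Y + Z\<close> is closed and direct. In a hereditarily indecomposable space this
is impossible, so the frontier of the spectrum has at most one point, and a bounded planar set
whose frontier lies in \<open>{\<alpha>}\<close> is itself contained in \<open>{\<alpha>}\<close>.

\<^bold>\<open>One spectral value.\<close> If \<open>\<bar>\<alpha>\<bar> < 1\<close>, then \<open>f (T\<^sup>n x)\<close> tends to \<open>0\<close> for every functional \<open>f\<close>. If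
\<open>\<bar>\<alpha>\<bar> \<ge> 1\<close>, write \<open>T = \<alpha> (1 + Q)\<close>. The series with coefficients \<open>q\<^sub>k = f (Q\<^sup>k x)\<close> has infinite radius
of convergence, as it represents the function \<open>f ((1 - u Q)\<^sup>-\<^sup>1 x)\<close>, which is entire
(\<open>orbit_power_series\<close>). The binomial formula gives
\<open>g n = \<alpha>\<^sup>-\<^sup>n f (T\<^sup>n x) = (\<Sum>k. (n choose k) * q\<^sub>k)\<close>, and replacing \<open>n\<close> by a complex variable turns this
into a Newton series, an entire function of exponential type zero. Such a function has only \<open>o(N)\<close>
zeros in \<open>{0..N}\<close>, so the successive differences of the real and of the imaginary part of \<open>g\<close>
change sign only \<open>o(N)\<close> times up to \<open>N\<close>. On the other hand, the open set of all \<open>u\<close> with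
\<open>\<bar>f u\<bar> < 1\<close> and \<open>\<bar>f (T u) / \<alpha> - f u\<bar> > 4\<close> is not empty. A visit at time \<open>n\<close> means that \<open>g n\<close> is
small and that \<open>g\<close> makes a large jump to \<open>g (n + 1)\<close>; the sequence has to turn around before it can be
small again. Hence the visits are as rare as the sign changes
(\<open>complex_binomial_transform_rare_jumps\<close>).

Both the smallness and the jump size carry the factor \<open>\<bar>\<alpha>\<bar>\<^sup>-\<^sup>n\<close>. It does not increase with \<open>n\<close>, so a
value reached by a jump stays too large for the smallness condition at all later times.
\<close>

section \<open>Bounded complex-linear maps\<close>

lemma bounded_clinear_iff:
  "bounded_clinear T \<longleftrightarrow> (\<forall>x y. T (x + y) = T x + T y) \<and> (\<forall>c x. T (c *\<^sub>C x) = c *\<^sub>C T x) \<and>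
    (\<exists>K. \<forall>x. norm (T x) \<le> K * norm x)"
  by (auto simp: bounded_clinear_def Vector_Spaces.linear_iff complex_vector.vector_space_axioms)

lemma bounded_clinear_add: "bounded_clinear T \<Longrightarrow> T (x + y) = T x + T y"
  and bounded_clinear_scaleC: "bounded_clinear T \<Longrightarrow> T (c *\<^sub>C x) = c *\<^sub>C T x"
  by (auto simp: bounded_clinear_iff)

lemma bounded_clinear_scaleR: "bounded_clinear T \<Longrightarrow> T (r *\<^sub>R x) = r *\<^sub>R T x"
  by (metis bounded_clinear_scaleC scaleC_of_real)

lemma bounded_clinear_imp_bounded_linear:
  assumes "bounded_clinear T"
  shows "bounded_linear T"
proof -
  obtain K where "\<And>x. norm (T x) \<le> K * norm x"
    using assms by (auto simp: bounded_clinear_iff)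
  then show ?thesis
    using assms by (intro bounded_linear_intro[where K = K])
      (simp_all add: bounded_clinear_add bounded_clinear_scaleR mult.commute)
qed

lemma bounded_clinear_diff: "bounded_clinear T \<Longrightarrow> T (x - y) = T x - T y"
  and bounded_clinear_zero: "bounded_clinear T \<Longrightarrow> T 0 = 0"
  and bounded_clinear_sum: "bounded_clinear T \<Longrightarrow> T (sum g A) = (\<Sum>i\<in>A. T (g i))"
  by (simp_all add: bounded_clinear_imp_bounded_linear bounded_linear.linear linear_diff
      linear_0 linear_sum)

lemma bounded_clinear_tendsto:
  "bounded_clinear T \<Longrightarrow> (g \<longlongrightarrow> a) F \<Longrightarrow> ((\<lambda>x. T (g x)) \<longlongrightarrow> T a) F"
  by (simp add: bounded_clinear_imp_bounded_linear bounded_linear.tendsto)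

lemma bounded_clinear_bound:
  assumes "bounded_clinear T"
  obtains K where "K > 0" "\<And>x. norm (T x) \<le> K * norm x"
  using bounded_linear.pos_bounded[OF bounded_clinear_imp_bounded_linear[OF assms]]
  by (metis mult.commute)

lemma bounded_clinear_compose:
  assumes "bounded_clinear f" "bounded_clinear g"
  shows "bounded_clinear (\<lambda>x. f (g x))"
proof -
  obtain K L where K: "K > 0" "\<And>x. norm (f x) \<le> K * norm x" and L: "\<And>x. norm (g x) \<le> L * norm x"
    using assms by (metis bounded_clinear_bound)
  have "norm (f (g x)) \<le> (K * L) * norm x" for x
    using order_trans[OF K(2)[of "g x"] mult_left_mono[OF L[of x], of K]] K(1) by (simp add: mult.assoc)
  then have "\<exists>K. \<forall>x. norm (f (g x)) \<le> K * norm x" by blast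
  then show ?thesis
    using assms unfolding bounded_clinear_iff by simp
qed

lemma bounded_clinear_scaleC_map: "bounded_clinear (\<lambda>x. c *\<^sub>C x)"
  unfolding bounded_clinear_iff
  by (auto simp: scaleC_add_right scaleC_scaleC norm_scaleC mult.commute intro!: exI[of _ "cmod c"])

lemma bounded_clinear_sub_scaleC:
  assumes "bounded_clinear T"
  shows "bounded_clinear (\<lambda>x. T x - c *\<^sub>C x)"
proof -
  obtain K where K: "\<And>x. norm (T x) \<le> K * norm x"
    using assms by (metis bounded_clinear_bound)
  have "norm (T x - c *\<^sub>C x) \<le> (K + cmod c) * norm x" for x
    using norm_triangle_ineq4[of "T x" "c *\<^sub>C x"] K[of x] by (simp add: norm_scaleC algebra_simps)
  then have "\<exists>K. \<forall>x. norm (T x - c *\<^sub>C x) \<le> K * norm x" by blast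
  then show ?thesis
    using assms unfolding bounded_clinear_iff
    by (auto simp: algebra_simps scaleC_add_right scaleC_scaleC complex_vector.scale_right_diff_distrib)
qed

lemma bounded_clinear_mult_scaleC:
  assumes "bounded_clinear T"
  shows "bounded_clinear (\<lambda>x. c *\<^sub>C T x)"
proof -
  obtain K where K: "\<And>x. norm (T x) \<le> K * norm x"
    using assms by (metis bounded_clinear_bound)
  have "norm (c *\<^sub>C T x) \<le> (cmod c * K) * norm x" for x
    using mult_left_mono[OF K[of x], of "cmod c"] by (simp add: norm_scaleC mult.assoc)
  then have "\<exists>K. \<forall>x. norm (c *\<^sub>C T x) \<le> K * norm x" by blast
  then show ?thesis
    using assms unfolding bounded_clinear_iff
    by (auto simp: algebra_simps scaleC_add_right scaleC_scaleC)
qed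

section \<open>Dominated functionals\<close>

definition sublinear :: "('a::real_vector \<Rightarrow> real) \<Rightarrow> bool"
  where "sublinear p \<longleftrightarrow> (\<forall>x y. p (x + y) \<le> p x + p y) \<and> (\<forall>t>0. \<forall>x. p (t *\<^sub>R x) \<le> t * p x)"

lemma sublinear_add: "sublinear p \<Longrightarrow> p (x + y) \<le> p x + p y"
  and sublinear_scale_le: "sublinear p \<Longrightarrow> t > 0 \<Longrightarrow> p (t *\<^sub>R x) \<le> t * p x"
  by (auto simp: sublinear_def)

lemma sublinear_scale:
  assumes "sublinear p" "t > 0"
  shows "p (t *\<^sub>R x) = t * p x"
proof -
  have "p x \<le> (1 / t) * p (t *\<^sub>R x)"
    using sublinear_scale_le[OF assms(1), of "1 / t" "t *\<^sub>R x"] assms(2) by simp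
  then have "t * p x \<le> p (t *\<^sub>R x)"
    using assms(2) by (simp add: field_simps)
  then show ?thesis
    using sublinear_scale_le[OF assms, of x] by simp
qed

lemma sublinear_zero: "sublinear p \<Longrightarrow> p 0 = 0"
  using sublinear_scale[of p 2 0] by simp

lemma sublinear_minus: "sublinear p \<Longrightarrow> - p (- x) \<le> p x"
  using sublinear_add[of p x "- x"] sublinear_zero[of p] by simp

text \<open>The Hahn--Banach theorem is obtained from the fact that the pointwise minimal sublinear functionals are
exactly the linear ones. This operation produces the candidate that minimality is tested
against: the largest sublinear functional below \<open>p\<close> whose value at \<open>- x\<close> is at most \<open>- p x\<close>.\<close>

definition lower_along :: "('a::real_vector \<Rightarrow> real) \<Rightarrow> 'a \<Rightarrow> 'a \<Rightarrow> real"
  where "lower_along p x y = (INF t\<in>{0..}. p (y + t *\<^sub>R x) - t * p x)"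

context
  fixes p :: "'a::real_vector \<Rightarrow> real" and x :: 'a
  assumes p: "sublinear p"
begin

lemma lower_along_le:
  assumes "t \<ge> 0"
  shows "lower_along p x y \<le> p (y + t *\<^sub>R x) - t * p x"
  unfolding lower_along_def
proof (rule cINF_lower)
  have "- p (- y) \<le> p (y + t *\<^sub>R x) - t * p x" if "t \<ge> 0" for t
  proof -
    have "t * p x = p (t *\<^sub>R x)"
      using sublinear_scale[OF p] sublinear_zero[OF p] that by (cases "t = 0") auto
    moreover have "p (t *\<^sub>R x) \<le> p (y + t *\<^sub>R x) + p (- y)"
      using sublinear_add[OF p, of "y + t *\<^sub>R x" "- y"] by simp
    ultimately show ?thesis by simp
  qed
  then show "bdd_below ((\<lambda>t. p (y + t *\<^sub>R x) - t * p x) ` {0..})"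
    by (intro bdd_belowI2[where m = "- p (- y)"]) auto
qed (use assms in auto)

lemma lower_along_greatest:
  assumes "\<And>t. t \<ge> 0 \<Longrightarrow> b \<le> p (y + t *\<^sub>R x) - t * p x"
  shows "b \<le> lower_along p x y"
  unfolding lower_along_def by (rule cINF_greatest) (use assms in auto)

lemma lower_along_sublinear: "sublinear (lower_along p x)"
  unfolding sublinear_def
proof (intro conjI allI impI)
  fix y z
  have "lower_along p x (y + z) - (p (z + s *\<^sub>R x) - s * p x) \<le> lower_along p x y" if "s \<ge> 0" for s
  proof (rule lower_along_greatest)
    fix t :: real assume "t \<ge> 0"
    then show "lower_along p x (y + z) - (p (z + s *\<^sub>R x) - s * p x) \<le> p (y + t *\<^sub>R x) - t * p x"
      using lower_along_le[of "t + s" "y + z"] that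
        sublinear_add[OF p, of "y + t *\<^sub>R x" "z + s *\<^sub>R x"]
      by (simp add: algebra_simps)
  qed
  then have "lower_along p x (y + z) - lower_along p x y \<le> lower_along p x z"
    by (intro lower_along_greatest) (simp add: algebra_simps)
  then show "lower_along p x (y + z) \<le> lower_along p x y + lower_along p x z"
    by simp
next
  fix s :: real and y assume s: "s > 0"
  have "lower_along p x (s *\<^sub>R y) / s \<le> lower_along p x y"
  proof (rule lower_along_greatest)
    fix t :: real assume t: "t \<ge> 0"
    have "lower_along p x (s *\<^sub>R y) \<le> p (s *\<^sub>R (y + t *\<^sub>R x)) - (s * t) * p x"
      using lower_along_le[of "s * t" "s *\<^sub>R y"] s t by (simp add: algebra_simps)
    also have "\<dots> = s * (p (y + t *\<^sub>R x) - t * p x)"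
      using sublinear_scale[OF p s, of "y + t *\<^sub>R x"] by (simp only: right_diff_distrib mult.assoc)
    finally show "lower_along p x (s *\<^sub>R y) / s \<le> p (y + t *\<^sub>R x) - t * p x"
      using s by (simp add: field_simps)
  qed
  then show "lower_along p x (s *\<^sub>R y) \<le> s * lower_along p x y"
    using s by (simp add: field_simps)
qed

lemma lower_along_below: "lower_along p x y \<le> p y"
  using lower_along_le[of 0 y] by simp

end

text \<open>Zorn's lemma applies because a chain of sublinear functionals below \<open>p\<close> is bounded below at every
point \<open>x\<close> by \<open>- p (- x)\<close>, so that its pointwise infimum is finite and sublinear.\<close>

lemma minimal_sublinear_below:
  fixes p :: "'a::real_vector \<Rightarrow> real"
  assumes p: "sublinear p"
  obtains m where "sublinear m" "m \<le> p" "\<And>q. sublinear q \<Longrightarrow> q \<le> m \<Longrightarrow> q = m"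
proof -
  define A where "A = {q. sublinear q \<and> q \<le> p}"
  define r where "r = relation_of (\<lambda>f g :: 'a \<Rightarrow> real. g \<le> f) A"
  have r_iff: "(f, g) \<in> r \<longleftrightarrow> f \<in> A \<and> g \<in> A \<and> g \<le> f" for f g
    by (auto simp: r_def relation_of_def)
  have "\<exists>m\<in>A. \<forall>q\<in>A. q \<le> m \<longrightarrow> q = m"
  proof (rule predicate_Zorn)
    show "partial_order_on A (relation_of (\<lambda>f g :: 'a \<Rightarrow> real. g \<le> f) A)"
      by (rule partial_order_on_relation_ofI) auto
  next
    fix C assume "C \<in> Chains (relation_of (\<lambda>f g :: 'a \<Rightarrow> real. g \<le> f) A)"
    then have C: "f \<in> C \<Longrightarrow> g \<in> C \<Longrightarrow> f \<in> A \<and> g \<in> A \<and> (f \<le> g \<or> g \<le> f)" for f g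
      by (auto simp: Chains_def relation_of_def)
    show "\<exists>u\<in>A. \<forall>a\<in>C. u \<le> a"
    proof (cases "C = {}")
      case True
      then show ?thesis using p by (auto simp: A_def)
    next
      case False
      define u where "u x = (INF q\<in>C. q x)" for x
      have bdd: "bdd_below ((\<lambda>q. q x) ` C)" for x
      proof (rule bdd_belowI2[where m = "- p (- x)"])
        fix q assume "q \<in> C"
        then have "sublinear q" "q (- x) \<le> p (- x)"
          using C by (auto simp: A_def le_fun_def)
        then show "- p (- x) \<le> q x"
          using sublinear_minus[of q x] by simp
      qed
      have lower: "u x \<le> q x" if "q \<in> C" for q x
        unfolding u_def using that bdd by (intro cINF_lower)
      have greatest: "b \<le> u x" if "\<And>q. q \<in> C \<Longrightarrow> b \<le> q x" for b x
        unfolding u_def using that False by (intro cINF_greatest)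
      have "sublinear u"
        unfolding sublinear_def
      proof (intro conjI allI impI)
        fix x y
        have "u (x + y) \<le> q1 x + q2 y" if q12: "q1 \<in> C" "q2 \<in> C" for q1 q2
        proof -
          obtain q where q: "q \<in> C" "q x \<le> q1 x" "q y \<le> q2 y"
            using C[OF q12] q12 by (auto simp: le_fun_def)
          then have "sublinear q" using C by (auto simp: A_def)
          then show ?thesis
            using lower[OF q(1), of "x + y"] sublinear_add[of q x y] q by linarith
        qed
        then have "u (x + y) - q2 y \<le> u x" if "q2 \<in> C" for q2
          using that by (intro greatest) (simp add: algebra_simps)
        then have "u (x + y) - u x \<le> u y"
          by (intro greatest) (simp add: algebra_simps)
        then show "u (x + y) \<le> u x + u y" by simp
      next
        fix t :: real and x assume t: "t > 0"
        have "u (t *\<^sub>R x) / t \<le> u x"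
        proof (rule greatest)
          fix q assume q: "q \<in> C"
          then have "sublinear q" using C by (auto simp: A_def)
          then have "u (t *\<^sub>R x) \<le> t * q x"
            using lower[OF q, of "t *\<^sub>R x"] sublinear_scale[of q t x] t by simp
          then show "u (t *\<^sub>R x) / t \<le> q x"
            using t by (simp add: field_simps)
        qed
        then show "u (t *\<^sub>R x) \<le> t * u x"
          using t by (simp add: field_simps)
      qed
      moreover have "u \<le> p"
      proof -
        obtain q where q: "q \<in> C" using False by auto
        then have "q \<le> p" using C by (auto simp: A_def)
        then show ?thesis using lower[OF q] by (auto simp: le_fun_def intro: order_trans)
      qed
      ultimately show ?thesis
        using lower by (auto simp: A_def le_fun_def)
    qed
  qed
  then show ?thesis
    using that unfolding A_def by (blast intro: order_trans)
qed

text \<open>Minimality makes \<open>m\<close> invariant under \<open>lower_along\<close>, and the value \<open>t = 1\<close> in the infimum gives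
\<open>m y \<le> m (y + x) - m x\<close>, the inequality missing for additivity.\<close>

lemma minimal_sublinear_linear:
  assumes m: "sublinear m" and min: "\<And>q. sublinear q \<Longrightarrow> q \<le> m \<Longrightarrow> q = m"
  shows "linear m"
proof -
  have eq: "lower_along m x = m" for x
    using min[OF lower_along_sublinear[OF m, of x]] lower_along_below[OF m, of x]
    by (auto simp: le_fun_def)
  have add: "m (x + y) = m x + m y" for x y
    using lower_along_le[OF m, of 1 y x] eq[of y] sublinear_add[OF m, of x y] by simp
  have neg: "m (- x) = - m x" for x
    using add[of x "- x"] sublinear_zero[OF m] by simp
  have "m (t *\<^sub>R x) = t * m x" for t x
  proof (cases t "0::real" rule: linorder_cases)
    case less
    then have "m (- (t *\<^sub>R x)) = (- t) * m x"
      using sublinear_scale[OF m, of "- t" x] by simp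
    then show ?thesis using neg by simp
  qed (use sublinear_scale[OF m] sublinear_zero[OF m] in auto)
  then show ?thesis
    using add by (simp add: linear_iff)
qed

text \<open>Starting Zorn's lemma below \<open>lower_along p x\<close> instead of \<open>p\<close> forces the value \<open>- p x\<close> at \<open>- x\<close>, hence
\<open>p x\<close> at \<open>x\<close>.\<close>

lemma Hahn_Banach_sublinear:
  assumes p: "sublinear p"
  obtains g where "linear g" "\<And>y. g y \<le> p y" "g x = p x"
proof -
  obtain m where m: "sublinear m" "m \<le> lower_along p x" "\<And>q. sublinear q \<Longrightarrow> q \<le> m \<Longrightarrow> q = m"
    using minimal_sublinear_below[OF lower_along_sublinear[OF p, of x]] by metis
  have lin: "linear m" using minimal_sublinear_linear m by blast
  have le: "m y \<le> p y" for y
    using m(2) lower_along_below[OF p, of x y] by (auto simp: le_fun_def intro: order_trans)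
  have "m (- x) \<le> p (- x + 1 *\<^sub>R x) - 1 * p x"
    using m(2) lower_along_le[OF p, of 1 x "- x"] by (auto simp: le_fun_def intro: order_trans)
  then have "m x \<ge> p x"
    using linear_neg[OF lin, of x] sublinear_zero[OF p] by simp
  then show ?thesis
    using that[OF lin le] le[of x] by simp
qed

text \<open>The complexification \<open>f y = g y - \<i> g (\<i> y)\<close> of a dominated real functional \<open>g\<close> is dominated in
modulus, as multiplying \<open>y\<close> by a unit scalar makes \<open>f y\<close> real without changing \<open>p y\<close>. The same reason
excludes an imaginary part of \<open>f x\<close>, since \<open>g x = p x\<close> already exhausts the modulus.\<close>

lemma Hahn_Banach_seminorm:
  fixes p :: "'a::complex_normed_vector \<Rightarrow> real"
  assumes add: "\<And>x y. p (x + y) \<le> p x + p y"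
    and scale: "\<And>c x. p (c *\<^sub>C x) \<le> cmod c * p x"
    and bound: "\<And>x. p x \<le> norm x"
  obtains f :: "'a \<Rightarrow> complex" where "bounded_clinear f" "\<And>y. cmod (f y) \<le> p y"
    "f x = of_real (p x)"
proof -
  have "sublinear p"
    unfolding sublinear_def
  proof (intro conjI allI impI add)
    fix t :: real and x assume "t > 0"
    then show "p (t *\<^sub>R x) \<le> t * p x"
      using scale[of "of_real t" x] by (simp add: scaleC_of_real)
  qed
  then obtain g where g: "linear g" "\<And>y. g y \<le> p y" "g x = p x"
    using Hahn_Banach_sublinear by metis
  define f where "f y = Complex (g y) (- g (\<i> *\<^sub>C y))" for y
  have f_add: "f (y + z) = f y + f z" for y z
    by (simp add: f_def scaleC_add_right linear_add[OF g(1)] complex_eq_iff)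
  have f_scale: "f (c *\<^sub>C y) = c * f y" for c y
  proof -
    have "c = of_real (Re c) + of_real (Im c) * \<i>"
      by (simp add: complex_eq_iff)
    then have c: "c *\<^sub>C y = Re c *\<^sub>R y + Im c *\<^sub>R (\<i> *\<^sub>C y)"
      unfolding scaleC_of_real[symmetric] scaleC_scaleC scaleC_add_left[symmetric] by simp
    have "\<i> * c = of_real (Re c) * \<i> - of_real (Im c)"
      by (simp add: complex_eq_iff)
    then have ic: "\<i> *\<^sub>C c *\<^sub>C y = Re c *\<^sub>R (\<i> *\<^sub>C y) - Im c *\<^sub>R y"
      unfolding scaleC_of_real[symmetric] scaleC_scaleC
        complex_vector.scale_left_diff_distrib[symmetric] by simp
    show ?thesis
      unfolding f_def ic unfolding c
      by (simp add: linear_add[OF g(1)] linear_diff[OF g(1)] linear_scale[OF g(1)] complex_eq_iff algebra_simps)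
  qed
  have f_le: "cmod (f y) \<le> p y" for y
  proof -
    define c where "c = cnj (sgn (f y))"
    have "c * f y = of_real (cmod (f y))"
      unfolding c_def by (simp add: sgn_eq complex_norm_square[symmetric] field_simps power2_eq_square)
    then have "cmod (f y) = Re (f (c *\<^sub>C y))"
      by (simp add: f_scale)
    also have "\<dots> \<le> p (c *\<^sub>C y)"
      by (simp add: f_def g)
    also have "\<dots> \<le> cmod c * p y" by (rule scale)
    also have "\<dots> \<le> p y"
    proof (cases "f y = 0")
      case True
      have "0 \<le> p y"
        using scale[of 0 "y"] add[of y "- y"] scale[of "-1" y] add[of 0 0] by auto
      then show ?thesis using True by (simp add: c_def)
    qed (simp add: c_def norm_sgn)
    finally show ?thesis .
  qed
  have "bounded_clinear f"
    unfolding bounded_clinear_iff scaleC_complex_def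
    using f_add f_scale order_trans[OF f_le bound] by (auto intro!: exI[of _ 1])
  moreover have "f x = of_real (p x)"
  proof -
    have Re: "Re (f x) = p x" by (simp add: f_def g(3))
    have "(cmod (f x))\<^sup>2 \<le> (p x)\<^sup>2"
      by (intro power_mono f_le) simp
    then have "Im (f x) = 0"
      unfolding cmod_power2 Re by simp
    then show ?thesis using Re by (simp add: complex_eq_iff)
  qed
  ultimately show ?thesis using that f_le by blast
qed

lemma norming_functional:
  fixes x :: "'a::complex_normed_vector"
  obtains f :: "'a \<Rightarrow> complex" where "bounded_clinear f" "\<And>y. cmod (f y) \<le> norm y"
    "f x = of_real (norm x)"
  using Hahn_Banach_seminorm[of norm x] by (auto simp: norm_triangle_ineq norm_scaleC)

section \<open>Bounded inverses and the spectrum\<close>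

definition has_bounded_inverse :: "('a::complex_normed_vector \<Rightarrow> 'a) \<Rightarrow> bool"
  where "has_bounded_inverse S \<longleftrightarrow>
    (\<exists>R. bounded_clinear R \<and> (\<forall>x. R (S x) = x) \<and> (\<forall>x. S (R x) = x))"

definition spectrum :: "('a::complex_normed_vector \<Rightarrow> 'a) \<Rightarrow> complex set"
  where "spectrum T = {\<mu>. \<not> has_bounded_inverse (\<lambda>x. T x - \<mu> *\<^sub>C x)}"

lemma has_bounded_inverseI:
  assumes S: "bounded_clinear S" and surj: "\<And>y. \<exists>x. S x = y"
    and below: "\<And>x. norm x \<le> C * norm (S x)"
  shows "has_bounded_inverse S"
proof -
  have inj: "x = y" if "S x = S y" for x y
    using below[of "x - y"] that by (simp add: bounded_clinear_diff[OF S])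
  obtain R where R: "\<And>y. S (R y) = y" using surj by metis
  have RS: "R (S x) = x" for x by (rule inj) (rule R)
  have "R (x + y) = R x + R y" for x y
    by (rule inj) (simp add: R bounded_clinear_add[OF S])
  moreover have "R (c *\<^sub>C x) = c *\<^sub>C R x" for c x
    by (rule inj) (simp add: R bounded_clinear_scaleC[OF S])
  moreover have "norm (R x) \<le> C * norm x" for x
    using below[of "R x"] by (simp add: R)
  ultimately have "bounded_clinear R"
    unfolding bounded_clinear_iff by blast
  then show ?thesis
    unfolding has_bounded_inverse_def using R RS by blast
qed

text \<open>Solving \<open>S x + D x = y\<close> amounts to finding a fixed point of \<open>x \<mapsto> R (y - D x)\<close>, a contraction with
factor \<open>1 / 2\<close>.\<close>

lemma has_bounded_inverse_perturb:
  fixes S :: "'a::complex_banach \<Rightarrow> 'a"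
  assumes R: "bounded_clinear R" "\<And>x. R (S x) = x" "\<And>x. S (R x) = x"
    and D: "bounded_clinear D" and small: "\<And>x. norm (R (D x)) \<le> norm x / 2"
    and SD: "bounded_clinear (\<lambda>x. S x + D x)"
  shows "has_bounded_inverse (\<lambda>x. S x + D x)"
proof -
  obtain N where N: "N > 0" "\<And>x. norm (R x) \<le> N * norm x"
    using R(1) by (metis bounded_clinear_bound)
  show ?thesis
  proof (rule has_bounded_inverseI[OF SD])
    fix y
    have "dist (R (y - D a)) (R (y - D b)) \<le> (1 / 2) * dist a b" for a b
    proof -
      have "R (y - D a) - R (y - D b) = R (D (b - a))"
        by (simp add: bounded_clinear_diff[OF R(1), symmetric] bounded_clinear_diff[OF D])
      then show ?thesis
        using small[of "b - a"] by (simp add: dist_norm norm_minus_commute)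
    qed
    then obtain x where x: "R (y - D x) = x"
      using banach_fix_type[of "1 / 2" "\<lambda>x. R (y - D x)"] by auto
    then have "S x = y - D x" using R(3) by metis
    then show "\<exists>x. S x + D x = y" by (intro exI[of _ x]) simp
  next
    fix x
    have "x = R (S x + D x) - R (D x)"
      by (simp add: bounded_clinear_add[OF R(1)] R(2))
    then have "norm x \<le> norm (R (S x + D x)) + norm (R (D x))"
      by (metis norm_triangle_ineq4)
    then show "norm x \<le> (2 * N) * norm (S x + D x)"
      using small[of x] N(2)[of "S x + D x"] by simp
  qed
qed

lemma closed_spectrum:
  fixes T :: "'a::complex_banach \<Rightarrow> 'a"
  assumes T: "bounded_clinear T"
  shows "closed (spectrum T)"
  unfolding closed_def open_dist
proof (intro ballI)
  fix \<mu> assume "\<mu> \<in> - spectrum T"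
  then obtain R where R: "bounded_clinear R" "\<And>x. R (T x - \<mu> *\<^sub>C x) = x" "\<And>x. T (R x) - \<mu> *\<^sub>C R x = x"
    unfolding spectrum_def has_bounded_inverse_def by auto
  obtain N where N: "N > 0" "\<And>x. norm (R x) \<le> N * norm x"
    using R(1) by (metis bounded_clinear_bound)
  have "\<nu> \<in> - spectrum T" if "dist \<nu> \<mu> < 1 / (2 * N)" for \<nu>
  proof -
    define D where "D x = (\<mu> - \<nu>) *\<^sub>C x" for x :: 'a
    have eq: "(T x - \<mu> *\<^sub>C x) + D x = T x - \<nu> *\<^sub>C x" for x
      by (simp add: D_def complex_vector.scale_left_diff_distrib)
    have "has_bounded_inverse (\<lambda>x. (T x - \<mu> *\<^sub>C x) + D x)"
    proof (rule has_bounded_inverse_perturb[OF R])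
      show "bounded_clinear D"
        unfolding D_def by (rule bounded_clinear_scaleC_map)
      show "bounded_clinear (\<lambda>x. T x - \<mu> *\<^sub>C x + D x)"
        unfolding eq by (rule bounded_clinear_sub_scaleC[OF T])
      fix x :: 'a
      have "cmod (\<mu> - \<nu>) \<le> 1 / (2 * N)"
        using that by (simp add: dist_norm norm_minus_commute)
      then have "N * (cmod (\<mu> - \<nu>) * norm x) \<le> N * (1 / (2 * N) * norm x)"
        using N(1) by (intro mult_left_mono mult_right_mono) auto
      then show "norm (R (D x)) \<le> norm x / 2"
        using N(2)[of "D x"] N(1) by (simp add: D_def norm_scaleC)
    qed
    then show ?thesis unfolding eq by (simp add: spectrum_def)
  qed
  then show "\<exists>e>0. \<forall>\<nu>. dist \<nu> \<mu> < e \<longrightarrow> \<nu> \<in> - spectrum T"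
    using N(1) by (intro exI[of _ "1 / (2 * N)"]) auto
qed

lemma spectrum_bounded:
  fixes T :: "'a::complex_banach \<Rightarrow> 'a"
  assumes T: "bounded_clinear T"
  obtains K where "\<And>\<mu>. cmod \<mu> > K \<Longrightarrow> \<mu> \<notin> spectrum T"
proof -
  obtain K where K: "K > 0" "\<And>x. norm (T x) \<le> K * norm x"
    using T by (metis bounded_clinear_bound)
  have "\<mu> \<notin> spectrum T" if mu: "cmod \<mu> > 2 * K" for \<mu>
  proof -
    have mu0: "\<mu> \<noteq> 0" using mu K(1) by auto
    have "has_bounded_inverse (\<lambda>x. (- \<mu>) *\<^sub>C x + T x)"
    proof (rule has_bounded_inverse_perturb[where R = "\<lambda>x. (- 1 / \<mu>) *\<^sub>C x"])
      show "bounded_clinear (\<lambda>x. (- 1 / \<mu>) *\<^sub>C x :: 'a)"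
        by (rule bounded_clinear_scaleC_map)
      show "bounded_clinear T" by fact
      have eq: "(- \<mu>) *\<^sub>C x + T x = T x - \<mu> *\<^sub>C x" for x by simp
      show "bounded_clinear (\<lambda>x. (- \<mu>) *\<^sub>C x + T x)"
        unfolding eq by (rule bounded_clinear_sub_scaleC[OF T])
      fix x
      have "norm ((- 1 / \<mu>) *\<^sub>C T x) = norm (T x) / cmod \<mu>"
        by (simp add: norm_scaleC norm_divide)
      also have "\<dots> \<le> (K * norm x) / (2 * K)"
        using mu K by (intro frac_le) auto
      also have "\<dots> = norm x / 2" using K(1) by simp
      finally show "norm ((- 1 / \<mu>) *\<^sub>C T x) \<le> norm x / 2" .
      show "(- 1 / \<mu>) *\<^sub>C (- \<mu>) *\<^sub>C x = x" "(- \<mu>) *\<^sub>C (- 1 / \<mu>) *\<^sub>C x = x"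
        using mu0 by (simp_all add: scaleC_scaleC scaleC_one)
    qed
    then show ?thesis by (simp add: spectrum_def)
  qed
  then show ?thesis using that by blast
qed

text \<open>Near a boundary point of the spectrum the resolvent norms blow up, but preimages of controlled norm
under \<open>T - \<alpha>\<close> bound the resolvent at every \<open>\<mu>\<close> close to \<open>\<alpha>\<close> by a constant independent of \<open>\<mu>\<close>. For
\<open>\<mu>\<close> close enough this makes \<open>T - \<alpha>\<close> bounded below as well.\<close>

lemma open_onto_in_closure_resolvent:
  fixes T :: "'a::complex_banach \<Rightarrow> 'a"
  assumes T: "bounded_clinear T" and cl: "\<alpha> \<in> closure (- spectrum T)"
    and onto: "\<And>y. \<exists>x. T x - \<alpha> *\<^sub>C x = y \<and> norm x \<le> C * norm y"
  shows "\<alpha> \<notin> spectrum T"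
proof -
  define C' where "C' = max C 1"
  have C': "C' > 0" "C \<le> C'" by (auto simp: C'_def)
  obtain \<mu> where mu: "\<mu> \<notin> spectrum T" "dist \<mu> \<alpha> < 1 / (4 * C')"
    using cl C' unfolding closure_approachable by (metis ComplD divide_pos_pos mult_pos_pos zero_less_numeral zero_less_one)
  define \<epsilon> where "\<epsilon> = cmod (\<mu> - \<alpha>)"
  have eps: "\<epsilon> * C' \<le> 1 / 4" "\<epsilon> \<ge> 0"
    using mu(2) C' by (simp_all add: \<epsilon>_def dist_norm field_simps)
  obtain R where R: "bounded_clinear R" "\<And>x. R (T x - \<mu> *\<^sub>C x) = x" "\<And>x. T (R x) - \<mu> *\<^sub>C R x = x"
    using mu(1) unfolding spectrum_def has_bounded_inverse_def by auto
  define N where "N = onorm R"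
  have N: "norm (R y) \<le> N * norm y" for y
    unfolding N_def by (intro onorm bounded_clinear_imp_bounded_linear R)
  have N0: "N \<ge> 0"
    unfolding N_def by (intro onorm_pos_le bounded_clinear_imp_bounded_linear R)
  \<comment> \<open>Solving \<open>(T - \<alpha>) x = y\<close> gives \<open>R y = x + (\<mu> - \<alpha>) R x\<close>, hence a bound for \<open>N\<close> in terms of
    itself; closeness of \<open>\<mu>\<close> to \<open>\<alpha>\<close> makes the self-reference absorbable.\<close>
  have "norm (R y) \<le> (C' + \<epsilon> * N * C') * norm y" for y
  proof -
    obtain x where x: "T x - \<alpha> *\<^sub>C x = y" "norm x \<le> C * norm y" using onto by blast
    have x': "norm x \<le> C' * norm y"
      using x(2) C'(2) mult_right_mono[OF C'(2), of "norm y"] by simp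
    have "y = (T x - \<mu> *\<^sub>C x) + (\<mu> - \<alpha>) *\<^sub>C x"
      using x(1) by (simp add: complex_vector.scale_left_diff_distrib)
    then have "R y = x + (\<mu> - \<alpha>) *\<^sub>C R x"
      by (simp add: bounded_clinear_add[OF R(1)] bounded_clinear_scaleC[OF R(1)] R(2))
    then have "norm (R y) \<le> norm x + \<epsilon> * norm (R x)"
      by (metis norm_triangle_ineq norm_scaleC \<epsilon>_def)
    also have "\<dots> \<le> C' * norm y + \<epsilon> * (N * (C' * norm y))"
      using x' N[of x] eps N0 by (intro add_mono mult_left_mono order_trans[OF N] mult_left_mono) auto
    finally show ?thesis by (simp add: algebra_simps)
  qed
  then have "N \<le> C' + \<epsilon> * N * C'"
    unfolding N_def by (rule onorm_bound[rotated]) (use C' eps N0 in \<open>simp add: N_def[symmetric]\<close>)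
  moreover have "\<epsilon> * N * C' \<le> N / 4"
    using mult_left_mono[OF eps(1) N0] by (simp add: algebra_simps)
  ultimately have N2: "N \<le> 2 * C'" using N0 by simp
  have "has_bounded_inverse (\<lambda>x. T x - \<alpha> *\<^sub>C x)"
  proof (rule has_bounded_inverseI[OF bounded_clinear_sub_scaleC[OF T]])
    show "\<exists>x. T x - \<alpha> *\<^sub>C x = y" for y using onto by blast
    fix x
    have "T x - \<mu> *\<^sub>C x = (T x - \<alpha> *\<^sub>C x) - (\<mu> - \<alpha>) *\<^sub>C x"
      by (simp add: complex_vector.scale_left_diff_distrib)
    then have "R (T x - \<mu> *\<^sub>C x) = R (T x - \<alpha> *\<^sub>C x) - (\<mu> - \<alpha>) *\<^sub>C R x"
      by (simp only: bounded_clinear_diff[OF R(1)] bounded_clinear_scaleC[OF R(1)])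
    then have "x = R (T x - \<alpha> *\<^sub>C x) - (\<mu> - \<alpha>) *\<^sub>C R x"
      using R(2)[of x] by simp
    then have "norm x \<le> norm (R (T x - \<alpha> *\<^sub>C x)) + \<epsilon> * norm (R x)"
      by (metis norm_triangle_ineq4 norm_scaleC \<epsilon>_def)
    moreover have "\<epsilon> * norm (R x) \<le> norm x / 2"
    proof -
      have "\<epsilon> * norm (R x) \<le> \<epsilon> * ((2 * C') * norm x)"
        using N[of x] mult_right_mono[OF N2, of "norm x"] eps by (intro mult_left_mono) auto
      also have "\<dots> = (\<epsilon> * C') * (2 * norm x)" by simp
      also have "\<dots> \<le> (1 / 4) * (2 * norm x)"
        using eps by (intro mult_right_mono) auto
      finally show ?thesis by simp
    qed
    ultimately show "norm x \<le> (2 * N) * norm (T x - \<alpha> *\<^sub>C x)"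
      using N[of "T x - \<alpha> *\<^sub>C x"] by simp
  qed
  then show ?thesis by (simp add: spectrum_def)
qed

section \<open>The orbit of a functional as a power series\<close>

text \<open>The resolvent identity makes \<open>u \<mapsto> f ((1 - u S)\<^sup>-\<^sup>1 x)\<close> holomorphic on the whole disc of radius \<open>r\<close>. For
small \<open>u\<close> the Neumann series identifies its Taylor coefficients as \<open>f (S\<^sup>n x)\<close>, and a Taylor
series converges in every disc on which the function is holomorphic.\<close>

lemma orbit_power_series:
  fixes S :: "'a::complex_banach \<Rightarrow> 'a" and f :: "'a \<Rightarrow> complex"
  assumes S: "bounded_clinear S" and f: "bounded_clinear f"
    and inv: "\<And>u. cmod u < r \<Longrightarrow> has_bounded_inverse (\<lambda>x. x - u *\<^sub>C S x)"
    and w: "cmod w < r"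
  shows "summable (\<lambda>n. f ((S ^^ n) x) * w ^ n)"
proof -
  have r: "r > 0" using w by (meson norm_ge_zero order_le_less_trans)
  obtain V where V: "\<And>u. cmod u < r \<Longrightarrow> bounded_clinear (V u)"
    and V1: "\<And>u x. cmod u < r \<Longrightarrow> V u (x - u *\<^sub>C S x) = x"
    and V2: "\<And>u x. cmod u < r \<Longrightarrow> V u x - u *\<^sub>C S (V u x) = x"
  proof -
    have "\<exists>R. cmod u < r \<longrightarrow> bounded_clinear R \<and> (\<forall>x. R (x - u *\<^sub>C S x) = x) \<and>
        (\<forall>x. R x - u *\<^sub>C S (R x) = x)" for u
      using inv[of u] unfolding has_bounded_inverse_def by blast
    then obtain V where "\<forall>u. cmod u < r \<longrightarrow> bounded_clinear (V u) \<and>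
        (\<forall>x. V u (x - u *\<^sub>C S x) = x) \<and> (\<forall>x. V u x - u *\<^sub>C S (V u x) = x)"
      by metis
    then show ?thesis using that[of V] by blast
  qed
  obtain K where K: "K > 0" "\<And>x. norm (S x) \<le> K * norm x"
    using S by (metis bounded_clinear_bound)
  obtain L where L: "L > 0" "\<And>x. norm (f x) \<le> L * norm x"
    using f by (metis bounded_clinear_bound)
  have resolvent: "V u z - V v z = (u - v) *\<^sub>C V u (S (V v z))" if "cmod u < r" "cmod v < r" for u v z
  proof -
    have "V v z - u *\<^sub>C S (V v z) = z - (u - v) *\<^sub>C S (V v z)"
      using V2[OF that(2), of z] by (simp add: complex_vector.scale_left_diff_distrib algebra_simps)
    then have "V v z = V u (z - (u - v) *\<^sub>C S (V v z))"
      using V1[OF that(1), of "V v z"] by simp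
    then have "V v z = V u z - (u - v) *\<^sub>C V u (S (V v z))"
      by (simp add: bounded_clinear_diff[OF V[OF that(1)]] bounded_clinear_scaleC[OF V[OF that(1)]])
    moreover have "a - b = c" if "b = a - c" for a b c :: 'a
      using that by simp
    ultimately show ?thesis by blast
  qed
  \<comment> \<open>By the resolvent identity \<open>V u z\<close> differs from \<open>V v z\<close> by at most half its own norm if \<open>u\<close> is near
    \<open>v\<close>; this bounds \<open>V\<close> locally uniformly, and continuity follows from the same identity.\<close>
  have V_tendsto: "((\<lambda>u. V u z) \<longlongrightarrow> V v z) (at v)"
    and V_bound: "\<exists>\<delta>>0. \<exists>N. \<forall>u z. dist u v < \<delta> \<longrightarrow> cmod u < r \<and> norm (V u z) \<le> N * norm z"
    if v: "cmod v < r" for v z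
  proof -
    obtain N where N: "N > 0" "\<And>z. norm (V v z) \<le> N * norm z"
      using V[OF v] by (metis bounded_clinear_bound)
    define \<delta> where "\<delta> = min (r - cmod v) (1 / (2 * (N * K)))"
    have d: "\<delta> > 0" using v N(1) K(1) by (simp add: \<delta>_def)
    have near: "cmod u < r \<and> norm (V u z) \<le> (2 * N) * norm z" if u: "dist u v < \<delta>" for u z
    proof
      have uv: "cmod (u - v) < r - cmod v" "cmod (u - v) \<le> 1 / (2 * (N * K))"
        using u by (auto simp: \<delta>_def dist_norm)
      show ur: "cmod u < r" using uv(1) norm_triangle_ineq2[of u v] by simp
      have "norm (V v (S (V u z))) \<le> (N * K) * norm (V u z)"
        using order_trans[OF N(2) mult_left_mono[OF K(2)]] N(1) by (simp add: mult.assoc)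
      then have "cmod (v - u) * norm (V v (S (V u z))) \<le> (1 / (2 * (N * K))) * ((N * K) * norm (V u z))"
        using uv(2) N(1) K(1) by (intro mult_mono) (auto simp: norm_minus_commute)
      also have "\<dots> = norm (V u z) / 2" using N(1) K(1) by simp
      finally have "norm (V v z - V u z) \<le> norm (V u z) / 2"
        unfolding resolvent[OF v ur] norm_scaleC .
      then show "norm (V u z) \<le> (2 * N) * norm z"
        using N(2)[of z] norm_triangle_ineq2[of "V u z" "V v z"] by (simp add: norm_minus_commute)
    qed
    then show "\<exists>\<delta>>0. \<exists>N. \<forall>u z. dist u v < \<delta> \<longrightarrow> cmod u < r \<and> norm (V u z) \<le> N * norm z"
      using d by blast
    define M where "M = (2 * N) * norm (S (V v z))"
    have "eventually (\<lambda>u. norm (V u z - V v z) \<le> M * cmod (u - v)) (at v)"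
    proof (rule eventually_mono[OF eventually_at_ball[OF d, of v UNIV]])
      fix u assume "u \<in> ball v \<delta> \<and> u \<in> UNIV"
      then have u: "dist u v < \<delta>" by (simp add: dist_commute)
      have "norm (V u z - V v z) = cmod (u - v) * norm (V u (S (V v z)))"
        using near[OF u] by (simp add: resolvent v norm_scaleC)
      then show "norm (V u z - V v z) \<le> M * cmod (u - v)"
        using mult_left_mono[OF conjunct2[OF near[OF u, of "S (V v z)"]], of "cmod (u - v)"]
        by (simp add: M_def mult_ac)
    qed
    moreover have "((\<lambda>u. M * cmod (u - v)) \<longlongrightarrow> 0) (at v)"
      by (rule tendsto_eq_intros refl | simp)+
    ultimately have "((\<lambda>u. V u z - V v z) \<longlongrightarrow> 0) (at v)"
      by (rule Lim_null_comparison)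
    then show "((\<lambda>u. V u z) \<longlongrightarrow> V v z) (at v)"
      by (rule LIM_zero_cancel)
  qed
  define \<phi> where "\<phi> u = f (V u x)" for u
  have hol: "\<phi> holomorphic_on ball 0 r"
    unfolding holomorphic_on_open[OF open_ball]
  proof (intro ballI exI)
    fix v :: complex assume "v \<in> ball 0 r"
    then have v: "cmod v < r" by simp
    define z where "z = S (V v x)"
    obtain \<delta> where \<delta>: "\<delta> > 0" "\<And>u. dist u v < \<delta> \<Longrightarrow> cmod u < r"
      using V_bound[OF v] by blast
    have "((\<lambda>u. f (V u z)) \<longlongrightarrow> f (V v z)) (at v)"
      by (intro bounded_clinear_tendsto[OF f] V_tendsto v)
    moreover have "eventually (\<lambda>u. f (V u z) = (\<phi> u - \<phi> v) / (u - v)) (at v)"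
    proof (rule eventually_mono[OF eventually_at_ball'[OF \<delta>(1), of v UNIV]])
      fix u assume "u \<in> ball v \<delta> \<and> u \<noteq> v \<and> u \<in> UNIV"
      then have u: "cmod u < r" "u \<noteq> v" using \<delta>(2)[of u] by (auto simp: dist_commute)
      have "\<phi> u - \<phi> v = (u - v) * f (V u z)"
        unfolding \<phi>_def bounded_clinear_diff[OF f, symmetric] resolvent[OF u(1) v] z_def
        by (simp add: bounded_clinear_scaleC[OF f] scaleC_complex_def)
      then show "f (V u z) = (\<phi> u - \<phi> v) / (u - v)" using u(2) by simp
    qed
    ultimately show "(\<phi> has_field_derivative f (V v z)) (at v)"
      unfolding has_field_derivative_iff by (rule Lim_transform_eventually)
  qed
  have expansion: "\<phi> has_fps_expansion Abs_fps (\<lambda>n. f ((S ^^ n) x))"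
  proof (rule has_fps_expansionI)
    obtain \<delta> N where \<delta>: "\<delta> > 0" and N: "\<And>u z. dist u 0 < \<delta> \<Longrightarrow> cmod u < r \<and> norm (V u z) \<le> N * norm z"
      using V_bound[of 0] r by auto
    show "\<forall>\<^sub>F u in nhds 0. (\<lambda>n. fps_nth (Abs_fps (\<lambda>n. f ((S ^^ n) x))) n * u ^ n) sums \<phi> u"
      unfolding eventually_nhds_metric
    proof (intro exI conjI allI impI)
      show "min \<delta> (1 / K) > 0" using \<delta> K(1) by simp
      fix u :: complex assume "dist u 0 < min \<delta> (1 / K)"
      then have u: "dist u 0 < \<delta>" "cmod u * K < 1" using K(1) by (auto simp: field_simps)
      then have ur: "cmod u < r" using N by blast
      have comm: "S (V u z) = V u (S z)" for z
      proof -
        have "V u z - u *\<^sub>C S (V u z) = z" by (rule V2[OF ur])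
        then have "S z = S (V u z) - u *\<^sub>C S (S (V u z))"
          using bounded_clinear_diff[OF S] bounded_clinear_scaleC[OF S] by metis
        then show ?thesis using V1[OF ur, of "S (V u z)"] by simp
      qed
      \<comment> \<open>Iterating \<open>V u z = z + u V u (S z)\<close> gives the Neumann series with its remainder.\<close>
      have partial: "\<phi> u = (\<Sum>k<n. f ((S ^^ k) x) * u ^ k) + u ^ n * f (V u ((S ^^ n) x))" for n
      proof (induction n)
        case (Suc n)
        have "V u ((S ^^ n) x) = (S ^^ n) x + u *\<^sub>C V u ((S ^^ Suc n) x)"
          using V2[OF ur, of "(S ^^ n) x"] by (simp add: comm algebra_simps)
        then have "f (V u ((S ^^ n) x)) = f ((S ^^ n) x) + u * f (V u ((S ^^ Suc n) x))"
          by (simp only: bounded_clinear_add[OF f] bounded_clinear_scaleC[OF f] scaleC_complex_def)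
        then show ?case using Suc by (simp add: algebra_simps)
      qed (simp add: \<phi>_def)
      have powS: "norm ((S ^^ n) x) \<le> K ^ n * norm x" for n
      proof (induction n)
        case (Suc n)
        then show ?case
          using order_trans[OF K(2) mult_left_mono[OF Suc]] K(1) by (simp add: mult.assoc)
      qed simp
      have rem: "norm (u ^ n * f (V u ((S ^^ n) x))) \<le> (L * \<bar>N\<bar> * norm x) * (cmod u * K) ^ n" for n
      proof -
        have "norm (V u ((S ^^ n) x)) \<le> \<bar>N\<bar> * norm ((S ^^ n) x)"
          using N[OF u(1), of "(S ^^ n) x"] mult_right_mono[OF abs_ge_self norm_ge_zero, of N "(S ^^ n) x"]
          by linarith
        also have "\<dots> \<le> \<bar>N\<bar> * (K ^ n * norm x)" by (intro mult_left_mono powS) simp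
        finally have "norm (f (V u ((S ^^ n) x))) \<le> L * (\<bar>N\<bar> * (K ^ n * norm x))"
          using order_trans[OF L(2) mult_left_mono] L(1) by simp
        then have "cmod u ^ n * norm (f (V u ((S ^^ n) x))) \<le> cmod u ^ n * (L * (\<bar>N\<bar> * (K ^ n * norm x)))"
          by (intro mult_left_mono) auto
        then show ?thesis by (simp add: norm_mult norm_power power_mult_distrib mult_ac)
      qed
      have "(\<lambda>n. (L * \<bar>N\<bar> * norm x) * (cmod u * K) ^ n) \<longlonglongrightarrow> (L * \<bar>N\<bar> * norm x) * 0"
        using u(2) K(1) by (intro tendsto_mult_left LIMSEQ_realpow_zero) auto
      then have lim: "(\<lambda>n. (L * \<bar>N\<bar> * norm x) * (cmod u * K) ^ n) \<longlonglongrightarrow> 0"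
        by (simp only: mult_zero_right)
      have "(\<lambda>n. u ^ n * f (V u ((S ^^ n) x))) \<longlonglongrightarrow> 0"
        by (rule Lim_null_comparison[OF always_eventually lim]) (rule allI, rule rem)
      then have "(\<lambda>n. \<phi> u - u ^ n * f (V u ((S ^^ n) x))) \<longlonglongrightarrow> \<phi> u - 0"
        by (intro tendsto_intros)
      moreover have "\<phi> u - u ^ n * f (V u ((S ^^ n) x)) = (\<Sum>k<n. f ((S ^^ k) x) * u ^ k)" for n
        using partial[of n] by simp
      ultimately show "(\<lambda>n. fps_nth (Abs_fps (\<lambda>n. f ((S ^^ n) x))) n * u ^ n) sums \<phi> u"
        by (simp add: sums_def)
    qed
  qed
  have "(\<lambda>n. fps_nth (Abs_fps (\<lambda>n. f ((S ^^ n) x))) n * w ^ n) sums \<phi> w"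
    by (rule has_fps_expansion_imp_sums_complex[OF expansion, of "ereal r"]) (use hol w in auto)
  then show ?thesis by (simp add: sums_iff)
qed

section \<open>Closed subspaces\<close>

text \<open>The distance to a subspace is the quotient seminorm, and this makes it available as the
dominating functional that separates a point from the subspace.\<close>

lemma infdist_subspace_seminorm:
  fixes M :: "'a::complex_normed_vector set"
  assumes M: "complex_vector.subspace M"
  shows "infdist (x + y) M \<le> infdist x M + infdist y M"
    and "infdist (c *\<^sub>C x) M \<le> cmod c * infdist x M"
    and "infdist x M \<le> norm x"
proof -
  have ne: "M \<noteq> {}" using complex_vector.subspace_0[OF M] by blast
  have greatest: "b \<le> infdist z M" if "\<And>a. a \<in> M \<Longrightarrow> b \<le> dist z a" for b z
    using ne that by (simp add: infdist_notempty cINF_greatest)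
  have "infdist (x + y) M - dist y b \<le> infdist x M" if b: "b \<in> M" for b
  proof (rule greatest)
    fix a assume a: "a \<in> M"
    have "infdist (x + y) M \<le> dist (x + y) (a + b)"
      by (intro infdist_le complex_vector.subspace_add[OF M] a b)
    also have "\<dots> \<le> dist x a + dist y b" by (rule dist_triangle_add)
    finally show "infdist (x + y) M - dist y b \<le> dist x a" by simp
  qed
  then have "infdist (x + y) M - infdist x M \<le> infdist y M"
    by (intro greatest) (simp add: algebra_simps)
  then show "infdist (x + y) M \<le> infdist x M + infdist y M" by simp
  show "infdist x M \<le> norm x"
    using infdist_le[OF complex_vector.subspace_0[OF M], of x] by simp
  show "infdist (c *\<^sub>C x) M \<le> cmod c * infdist x M"
  proof (cases "c = 0")
    case True
    then show ?thesis using complex_vector.subspace_0[OF M] by simp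
  next
    case False
    have "infdist (c *\<^sub>C x) M / cmod c \<le> infdist x M"
    proof (rule greatest)
      fix a assume "a \<in> M"
      then have "infdist (c *\<^sub>C x) M \<le> dist (c *\<^sub>C x) (c *\<^sub>C a)"
        by (intro infdist_le complex_vector.subspace_scale[OF M])
      also have "\<dots> = cmod c * dist x a"
        by (simp add: dist_norm complex_vector.scale_right_diff_distrib[symmetric] norm_scaleC)
      finally show "infdist (c *\<^sub>C x) M / cmod c \<le> dist x a"
        using False by (simp add: field_simps)
    qed
    then show ?thesis using False by (simp add: field_simps)
  qed
qed

lemma separating_functional:
  fixes M :: "'a::complex_normed_vector set"
  assumes M: "complex_vector.subspace M" and x: "x \<notin> closure M"
  obtains f :: "'a \<Rightarrow> complex" where "bounded_clinear f" "\<And>y. y \<in> M \<Longrightarrow> f y = 0" "f x \<noteq> 0"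
proof -
  obtain f :: "'a \<Rightarrow> complex" where f: "bounded_clinear f" "\<And>y. cmod (f y) \<le> infdist y M"
      "f x = of_real (infdist x M)"
    using Hahn_Banach_seminorm[of "\<lambda>y. infdist y M" x] infdist_subspace_seminorm[OF M] by blast
  have "f y = 0" if "y \<in> M" for y
    using f(2)[of y] that by simp
  moreover have "infdist x M \<noteq> 0"
    using x in_closure_iff_infdist_zero[of M x] complex_vector.subspace_0[OF M] by blast
  ultimately show ?thesis using that f by simp
qed

lemma subspace_image:
  assumes S: "bounded_clinear S" and M: "complex_vector.subspace M"
  shows "complex_vector.subspace (S ` M)"
proof (rule complex_vector.subspaceI)
  show "0 \<in> S ` M"
    using bounded_clinear_zero[OF S] complex_vector.subspace_0[OF M] by (metis imageI)
qed (use complex_vector.subspace_add[OF M] complex_vector.subspace_scale[OF M] in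
    \<open>auto simp: bounded_clinear_add[OF S, symmetric] bounded_clinear_scaleC[OF S, symmetric]\<close>)

lemma closed_kernel: "bounded_clinear f \<Longrightarrow> closed {x. f x = 0}"
  by (intro closed_Collect_eq continuous_on_const)
    (simp add: bounded_clinear_imp_bounded_linear bounded_linear.linear linear_continuous_on)

lemma subspace_kernel: "bounded_clinear f \<Longrightarrow> complex_vector.subspace {x. f x = 0}"
  by (auto intro!: complex_vector.subspaceI
      simp: bounded_clinear_zero bounded_clinear_add bounded_clinear_scaleC)

lemma subspace_closure:
  fixes M :: "'a::complex_normed_vector set"
  assumes M: "complex_vector.subspace M"
  shows "complex_vector.subspace (closure M)"
proof (rule complex_vector.subspaceI)
  show "0 \<in> closure M"
    using complex_vector.subspace_0[OF M] closure_subset by blast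
next
  fix x y assume "x \<in> closure M" "y \<in> closure M"
  then obtain a b where a: "\<And>n. a n \<in> M" "a \<longlonglongrightarrow> x" and b: "\<And>n. b n \<in> M" "b \<longlonglongrightarrow> y"
    unfolding closure_sequential by blast
  have "(\<lambda>n. a n + b n) \<longlonglongrightarrow> x + y" by (intro tendsto_add a b)
  then show "x + y \<in> closure M"
    unfolding closure_sequential using complex_vector.subspace_add[OF M a(1) b(1)]
    by (intro exI[of _ "\<lambda>n. a n + b n"]) blast
next
  fix c x assume "x \<in> closure M"
  then obtain a where a: "\<And>n. a n \<in> M" "a \<longlonglongrightarrow> x"
    unfolding closure_sequential by blast
  have "(\<lambda>n. c *\<^sub>C a n) \<longlonglongrightarrow> c *\<^sub>C x"
    by (intro bounded_clinear_tendsto[OF bounded_clinear_scaleC_map] a)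
  then show "c *\<^sub>C x \<in> closure M"
    unfolding closure_sequential using complex_vector.subspace_scale[OF M a(1)]
    by (intro exI[of _ "\<lambda>n. c *\<^sub>C a n"]) blast
qed

section \<open>Operators that are small on subspaces of finite codimension\<close>

definition common_kernel :: "('a::complex_normed_vector \<Rightarrow> complex) set \<Rightarrow> 'a set"
  where "common_kernel F = {x. \<forall>f\<in>F. f x = 0}"

definition infinitely_singular :: "('a::complex_normed_vector \<Rightarrow> 'a) \<Rightarrow> bool"
  where "infinitely_singular S \<longleftrightarrow>
    (\<forall>F e. finite F \<and> (\<forall>f\<in>F. bounded_clinear f) \<and> e > 0 \<longrightarrow>
      (\<exists>x\<in>common_kernel F. norm x = 1 \<and> norm (S x) < e))"

text \<open>This says that the restriction of \<open>S\<close> to \<open>M\<close> is open as a map onto its image. Unlike being bounded below, it tolerates a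
kernel and therefore passes from a subspace of finite codimension to the whole space.\<close>

definition open_onto_image :: "('a::complex_normed_vector \<Rightarrow> 'a) \<Rightarrow> 'a set \<Rightarrow> bool"
  where "open_onto_image S M \<longleftrightarrow>
    (\<exists>C\<ge>0. \<forall>x\<in>M. \<exists>x'\<in>M. S x' = S x \<and> norm x' \<le> C * norm (S x))"

lemma common_kernel_insert: "common_kernel (insert f F) = {x \<in> common_kernel F. f x = 0}"
  by (auto simp: common_kernel_def)

lemma common_kernel_closed_subspace:
  assumes "\<And>f. f \<in> F \<Longrightarrow> bounded_clinear f"
  shows "closed (common_kernel F)" "complex_vector.subspace (common_kernel F)"
proof -
  have eq: "common_kernel F = (\<Inter>f\<in>F. {x. f x = 0})" by (auto simp: common_kernel_def)
  show "closed (common_kernel F)"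
    unfolding eq using closed_kernel assms by blast
  show "complex_vector.subspace (common_kernel F)"
    unfolding eq by (rule complex_vector.subspace_Inter) (use subspace_kernel assms in blast)
qed

text \<open>A limit of points of the image is the sum of a rapidly convergent telescoping series in the image,
and the small terms of that series lift to a convergent series in \<open>M\<close>.\<close>

lemma open_onto_image_closed:
  fixes S :: "'a::complex_banach \<Rightarrow> 'a"
  assumes S: "bounded_clinear S" and M: "complex_vector.subspace M" "closed M"
    and o: "open_onto_image S M"
  shows "closed (S ` M)"
proof -
  obtain C where C: "C \<ge> 0" "\<And>x. x \<in> M \<Longrightarrow> \<exists>x'\<in>M. S x' = S x \<and> norm x' \<le> C * norm (S x)"
    using o unfolding open_onto_image_def by blast
  have SM: "complex_vector.subspace (S ` M)" by (rule subspace_image[OF S M(1)])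
  have "y \<in> S ` M" if y: "y \<in> closure (S ` M)" for y
  proof -
    have "\<exists>v\<in>S ` M. dist v y < (1 / 2) ^ n" for n
      using y unfolding closure_approachable by (meson half_gt_zero_iff zero_less_one zero_less_power)
    then obtain v where v: "\<And>n. v n \<in> S ` M" "\<And>n. dist (v n) y < (1 / 2) ^ n"
      by metis
    have dv: "norm (v (Suc n) - v n) \<le> 2 * (1 / 2) ^ n" for n
    proof -
      have "norm (v (Suc n) - v n) \<le> dist (v (Suc n)) y + dist (v n) y"
        using dist_triangle2[of "v (Suc n)" "v n" y] by (simp add: dist_norm)
      moreover have "(0 :: real) \<le> (1 / 2) ^ n" by simp
      moreover have "dist (v (Suc n)) y < (1 / 2) ^ n / 2" using v(2)[of "Suc n"] by simp
      ultimately show ?thesis using v(2)[of n] by linarith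
    qed
    have "\<exists>z\<in>M. S z = v (Suc n) - v n \<and> norm z \<le> C * (2 * (1 / 2) ^ n)" for n
    proof -
      have "v (Suc n) - v n \<in> S ` M" by (intro complex_vector.subspace_diff[OF SM] v(1))
      then obtain x where x: "x \<in> M" "v (Suc n) - v n = S x" by blast
      then show ?thesis
        using C(2)[OF x(1)] order_trans[OF _ mult_left_mono[OF dv[of n] C(1)]] by metis
    qed
    then obtain z where z: "\<And>n. z n \<in> M" "\<And>n. S (z n) = v (Suc n) - v n"
        "\<And>n. norm (z n) \<le> C * (2 * (1 / 2) ^ n)"
      by metis
    have "summable z"
    proof (rule summable_comparison_test')
      show "summable (\<lambda>n. C * (2 * (1 / 2) ^ n) :: real)"
        by (intro summable_mult summable_geometric) simp
    qed (use z in auto)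
    then have z_sums: "(\<lambda>n. \<Sum>k<n. z k) \<longlonglongrightarrow> suminf z"
      by (simp add: summable_LIMSEQ)
    have Z: "suminf z \<in> M"
      by (rule closed_sequentially[OF M(2) _ z_sums]) (intro complex_vector.subspace_sum[OF M(1)] z(1))
    have "(\<lambda>n. S (\<Sum>k<n. z k)) \<longlonglongrightarrow> S (suminf z)"
      by (intro bounded_clinear_tendsto[OF S] z_sums)
    moreover have "S (\<Sum>k<n. z k) = v n - v 0" for n
      by (simp add: bounded_clinear_sum[OF S] z(2) sum_lessThan_telescope)
    moreover have "(\<lambda>n. v n - v 0) \<longlonglongrightarrow> y - v 0"
    proof (intro tendsto_diff tendsto_const)
      have "(\<lambda>n. (1 / 2) ^ n :: real) \<longlonglongrightarrow> 0" by (intro LIMSEQ_realpow_zero) auto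
      then have "(\<lambda>n. dist (v n) y) \<longlonglongrightarrow> 0"
        by (rule Lim_null_comparison[rotated]) (use v(2) less_imp_le in \<open>auto intro!: always_eventually\<close>)
      then show "v \<longlonglongrightarrow> y" by (rule iffD2[OF tendsto_dist_iff])
    qed
    ultimately have "S (suminf z) = y - v 0"
      using LIMSEQ_unique by simp
    then have "y = S (suminf z) + v 0" by simp
    then show ?thesis
      using complex_vector.subspace_add[OF SM imageI[OF Z] v(1)] by simp
  qed
  then show ?thesis
    using closure_subset_eq by blast
qed

text \<open>The space \<open>N\<close> is spanned by the kernel \<open>M\<close> of \<open>f\<close> and one vector \<open>e\<close>. Either \<open>S e\<close> already has a
preimage in \<open>M\<close>, and every \<open>S x\<close> lies in the image of \<open>M\<close>; or \<open>S e\<close> lies outside this closed image,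
and a separating functional controls the coefficient \<open>f x\<close> of \<open>e\<close> by the norm of \<open>S x\<close>.\<close>

lemma open_onto_image_extend:
  fixes S :: "'a::complex_banach \<Rightarrow> 'a" and f :: "'a \<Rightarrow> complex"
  assumes S: "bounded_clinear S" and f: "bounded_clinear f"
    and N: "complex_vector.subspace N" "closed N"
    and o: "open_onto_image S {x \<in> N. f x = 0}"
  shows "open_onto_image S N"
proof (cases "\<forall>x\<in>N. f x = 0")
  case True
  then have "{x \<in> N. f x = 0} = N" by blast
  then show ?thesis using o by simp
next
  case False
  define M where "M = {x \<in> N. f x = 0}"
  have M_eq: "M = N \<inter> {x. f x = 0}" by (auto simp: M_def)
  have M: "complex_vector.subspace M" "closed M"
    unfolding M_eq using N closed_kernel[OF f] subspace_kernel[OF f]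
    by (auto intro: complex_vector.subspace_inter)
  obtain C where C: "C \<ge> 0" "\<And>x. x \<in> M \<Longrightarrow> \<exists>x'\<in>M. S x' = S x \<and> norm x' \<le> C * norm (S x)"
    using o unfolding open_onto_image_def M_def by blast
  obtain e0 where e0: "e0 \<in> N" "f e0 \<noteq> 0" using False by blast
  define e where "e = (1 / f e0) *\<^sub>C e0"
  have e: "e \<in> N" "f e = 1"
    unfolding e_def using e0
    by (auto intro: complex_vector.subspace_scale[OF N(1)] simp: bounded_clinear_scaleC[OF f] scaleC_complex_def)
  have proj: "x - f x *\<^sub>C e \<in> M" if "x \<in> N" for x
    unfolding M_def using that e
    by (auto intro!: complex_vector.subspace_diff[OF N(1)] complex_vector.subspace_scale[OF N(1)]
        simp: bounded_clinear_diff[OF f] bounded_clinear_scaleC[OF f] scaleC_complex_def)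
  have S_proj: "S (x - f x *\<^sub>C e) = S x - f x *\<^sub>C S e" for x
    by (simp add: bounded_clinear_diff[OF S] bounded_clinear_scaleC[OF S])
  show ?thesis
  proof (cases "S e \<in> S ` M")
    case True
    then obtain k where k: "k \<in> M" "S e = S k" by blast
    have "\<exists>x'\<in>N. S x' = S x \<and> norm x' \<le> C * norm (S x)" if x: "x \<in> N" for x
    proof -
      have "(x - f x *\<^sub>C e) + f x *\<^sub>C k \<in> M"
        by (intro complex_vector.subspace_add[OF M(1)] complex_vector.subspace_scale[OF M(1)] proj x k)
      moreover have "S ((x - f x *\<^sub>C e) + f x *\<^sub>C k) = S x"
        using k(2) by (simp add: bounded_clinear_add[OF S] S_proj bounded_clinear_scaleC[OF S])
      ultimately show ?thesis
        using C(2) unfolding M_def by fastforce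
    qed
    then show ?thesis unfolding open_onto_image_def using C(1) by blast
  next
    case False
    have cl: "closed (S ` M)"
      by (rule open_onto_image_closed[OF S M o[folded M_def]])
    obtain g0 :: "'a \<Rightarrow> complex" where g0: "bounded_clinear g0" "\<And>y. y \<in> S ` M \<Longrightarrow> g0 y = 0" "g0 (S e) \<noteq> 0"
      using separating_functional[OF subspace_image[OF S M(1)], of "S e"] False closure_closed[OF cl]
      by metis
    obtain L where L: "L > 0" "\<And>y. norm (g0 y) \<le> L * norm y"
      using g0(1) by (metis bounded_clinear_bound)
    define D where "D = L / cmod (g0 (S e))"
    have D: "D \<ge> 0" using L(1) by (simp add: D_def)
    have fx: "cmod (f x) \<le> D * norm (S x)" if x: "x \<in> N" for x
    proof -
      have "g0 (S x - f x *\<^sub>C S e) = 0"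
        using g0(2)[OF imageI[OF proj[OF x]]] by (simp add: S_proj)
      then have "g0 (S x) = f x * g0 (S e)"
        by (simp add: bounded_clinear_diff[OF g0(1)] bounded_clinear_scaleC[OF g0(1)] scaleC_complex_def)
      then have "cmod (f x) * cmod (g0 (S e)) \<le> L * norm (S x)"
        using L(2)[of "S x"] by (simp add: norm_mult)
      then show ?thesis using g0(3) by (simp add: D_def field_simps)
    qed
    define B where "B = C * (1 + D * norm (S e)) + D * norm e"
    have "\<exists>x'\<in>N. S x' = S x \<and> norm x' \<le> B * norm (S x)" if x: "x \<in> N" for x
    proof -
      obtain k where k: "k \<in> M" "S k = S x - f x *\<^sub>C S e" "norm k \<le> C * norm (S x - f x *\<^sub>C S e)"
        using C(2)[OF proj[OF x]] unfolding S_proj by blast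
      have "norm (S x - f x *\<^sub>C S e) \<le> norm (S x) + cmod (f x) * norm (S e)"
        using norm_triangle_ineq4 norm_scaleC by metis
      also have "\<dots> \<le> norm (S x) + (D * norm (S x)) * norm (S e)"
        by (intro add_left_mono mult_right_mono fx x) simp
      finally have "norm k \<le> C * (norm (S x) + (D * norm (S x)) * norm (S e))"
        using order_trans[OF k(3) mult_left_mono[OF _ C(1)]] by blast
      moreover have "norm (f x *\<^sub>C e) \<le> (D * norm (S x)) * norm e"
        unfolding norm_scaleC by (intro mult_right_mono fx x) simp
      ultimately have "norm (k + f x *\<^sub>C e) \<le> B * norm (S x)"
        using norm_triangle_ineq[of k "f x *\<^sub>C e"] by (simp add: B_def algebra_simps)
      moreover have "k + f x *\<^sub>C e \<in> N"
        using k(1) e(1) unfolding M_def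
        by (intro complex_vector.subspace_add[OF N(1)] complex_vector.subspace_scale[OF N(1)]) auto
      moreover have "S (k + f x *\<^sub>C e) = S x"
        by (simp add: bounded_clinear_add[OF S] bounded_clinear_scaleC[OF S] k(2))
      ultimately show ?thesis by blast
    qed
    moreover have "B \<ge> 0" using C(1) D by (simp add: B_def)
    ultimately show ?thesis unfolding open_onto_image_def by blast
  qed
qed

lemma not_infinitely_singular_imp_open_onto_image:
  fixes S :: "'a::complex_banach \<Rightarrow> 'a"
  assumes S: "bounded_clinear S" and "\<not> infinitely_singular S"
  shows "open_onto_image S UNIV"
proof -
  obtain F e where F: "finite F" "\<And>f. f \<in> F \<Longrightarrow> bounded_clinear f" and e: "e > 0"
    and below: "\<And>x. x \<in> common_kernel F \<Longrightarrow> norm x = 1 \<Longrightarrow> e \<le> norm (S x)"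
    using assms(2) unfolding infinitely_singular_def by (metis not_less)
  have "norm x \<le> (1 / e) * norm (S x)" if x: "x \<in> common_kernel F" for x
  proof (cases "x = 0")
    case False
    have "complex_of_real (1 / norm x) *\<^sub>C x \<in> common_kernel F"
      by (intro complex_vector.subspace_scale common_kernel_closed_subspace F x)
    moreover have "norm (complex_of_real (1 / norm x) *\<^sub>C x) = 1"
      using False by (simp only: norm_scaleC norm_of_real) simp
    ultimately have "e \<le> norm (S (complex_of_real (1 / norm x) *\<^sub>C x))"
      by (rule below)
    also have "\<dots> = norm (S x) / norm x"
      by (simp only: bounded_clinear_scaleC[OF S] norm_scaleC norm_of_real) simp
    finally show ?thesis using False e by (simp add: field_simps)
  qed (use e in simp)
  then have "open_onto_image S (common_kernel F)"
    unfolding open_onto_image_def using e by (intro exI[of _ "1 / e"]) auto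
  with F show ?thesis
  proof (induction F rule: finite_induct)
    case empty
    then show ?case by (simp add: common_kernel_def)
  next
    case (insert f F)
    then have "open_onto_image S (common_kernel F)"
      by (intro open_onto_image_extend[OF S _ common_kernel_closed_subspace(2,1)])
        (auto simp: common_kernel_insert)
    then show ?case using insert by blast
  qed
qed

section \<open>Hereditarily indecomposable spaces\<close>

text \<open>Each \<open>x n\<close> is chosen in the common kernel of the norming functionals of its predecessors. The
factor \<open>(1 / 4) ^ Suc n\<close> is there to beat the growth \<open>2 ^ n\<close> of the coefficients with respect to this
triangular system.\<close>

lemma infinitely_singular_small_sequence:
  fixes S :: "'a::complex_banach \<Rightarrow> 'a"
  assumes sing: "infinitely_singular S" and e: "e > 0"
  obtains x :: "nat \<Rightarrow> 'a" and f :: "nat \<Rightarrow> 'a \<Rightarrow> complex" where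
    "\<And>n. norm (x n) = 1" "\<And>n. norm (S (x n)) \<le> e * (1 / 4) ^ Suc n"
    "\<And>n. bounded_clinear (f n)" "\<And>n y. cmod (f n y) \<le> norm y" "\<And>n. f n (x n) = 1"
    "\<And>i n. i < n \<Longrightarrow> f i (x n) = 0"
proof -
  define P :: "(nat \<Rightarrow> 'a \<times> ('a \<Rightarrow> complex)) \<Rightarrow> nat \<Rightarrow> 'a \<times> ('a \<Rightarrow> complex) \<Rightarrow> bool" where
    "P h n r \<longleftrightarrow> norm (fst r) = 1 \<and> norm (S (fst r)) \<le> e * (1 / 4) ^ Suc n \<and>
      bounded_clinear (snd r) \<and> (\<forall>y. cmod (snd r y) \<le> norm y) \<and> snd r (fst r) = 1 \<and>
      (\<forall>i<n. snd (h i) (fst r) = 0)" for h n r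
  have "\<exists>h. \<forall>n. P h n (h n)"
  proof (rule dependent_wf_choice[OF wf_less])
    fix h g :: "nat \<Rightarrow> 'a \<times> ('a \<Rightarrow> complex)" and n r
    assume "\<And>z. (z, n) \<in> {(x, y). x < y} \<Longrightarrow> h z = g z"
    then show "P h n r = P g n r" by (simp add: P_def)
  next
    fix n h assume prev: "\<And>m. (m, n) \<in> {(x, y). x < y} \<Longrightarrow> P h m (h m)"
    define F where "F = (\<lambda>i. snd (h i)) ` {..<n}"
    have "finite F" "\<forall>f\<in>F. bounded_clinear f" "e * (1 / 4) ^ Suc n > 0"
      using prev e by (auto simp: F_def P_def)
    then obtain x where x: "x \<in> common_kernel F" "norm x = 1" "norm (S x) < e * (1 / 4) ^ Suc n"
      using sing unfolding infinitely_singular_def by blast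
    obtain f :: "'a \<Rightarrow> complex" where "bounded_clinear f" "\<And>y. cmod (f y) \<le> norm y" "f x = of_real (norm x)"
      using norming_functional[of x] by blast
    then have "P h n (x, f)"
      using x by (auto simp: P_def F_def common_kernel_def)
    then show "\<exists>r. P h n r" by blast
  qed
  then obtain h where "\<And>n. P h n (h n)" by blast
  then show ?thesis
    using that[of "\<lambda>n. fst (h n)" "\<lambda>n. snd (h n)"] by (simp add: P_def)
qed

text \<open>Applying \<open>f n\<close> isolates \<open>a n\<close> up to the earlier coefficients, each of which enters with a factor of
modulus at most \<open>1\<close>; so the bound doubles with each step.\<close>

lemma triangular_coefficient_bound:
  fixes x :: "nat \<Rightarrow> 'a::complex_normed_vector" and f :: "nat \<Rightarrow> 'a \<Rightarrow> complex"
  assumes f: "\<And>n. bounded_clinear (f n)" "\<And>n y. cmod (f n y) \<le> norm y"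
    and x: "\<And>n. norm (x n) = 1"
    and diag: "\<And>n. f n (x n) = 1" and tri: "\<And>i n. i < n \<Longrightarrow> f i (x n) = 0"
    and n: "n < N"
  shows "cmod (a n) \<le> 2 ^ n * norm (\<Sum>i<N. a i *\<^sub>C x i)"
  using n
proof (induction n rule: less_induct)
  case (less n)
  define y where "y = (\<Sum>i<N. a i *\<^sub>C x i)"
  have "f n y = (\<Sum>i<N. a i * f n (x i))"
    by (simp add: y_def bounded_clinear_sum[OF f(1)] bounded_clinear_scaleC[OF f(1)] scaleC_complex_def)
  also have "\<dots> = (\<Sum>i<Suc n. a i * f n (x i))"
    by (rule sum.mono_neutral_right) (use less.prems tri in auto)
  finally have "a n = f n y - (\<Sum>i<n. a i * f n (x i))"
    by (simp add: diag)
  then have "cmod (a n) \<le> cmod (f n y) + cmod (\<Sum>i<n. a i * f n (x i))"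
    by (metis norm_triangle_ineq4)
  also have "\<dots> \<le> norm y + (\<Sum>i<n. 2 ^ i * norm y)"
  proof (intro add_mono f(2) sum_norm_le)
    fix i assume "i \<in> {..<n}"
    then have "cmod (a i) \<le> 2 ^ i * norm y"
      unfolding y_def using less by simp
    then have "cmod (a i) * cmod (f n (x i)) \<le> (2 ^ i * norm y) * 1"
      using f(2)[of n "x i"] x[of i] by (intro mult_mono) auto
    then show "cmod (a i * f n (x i)) \<le> 2 ^ i * norm y"
      by (simp add: norm_mult)
  qed
  also have "\<dots> = 2 ^ n * norm y"
    by (induction n) (simp_all add: algebra_simps)
  finally show ?case by (simp add: y_def)
qed

lemma infinitely_singular_small_subspace:
  fixes S :: "'a::complex_banach \<Rightarrow> 'a"
  assumes S: "bounded_clinear S" and sing: "infinitely_singular S" and e: "e > 0"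
  obtains Y where "complex_vector.subspace Y" "closed Y" "infinite_dimensional Y"
    "\<And>y. y \<in> Y \<Longrightarrow> norm (S y) \<le> e * norm y"
proof -
  obtain x :: "nat \<Rightarrow> 'a" and f :: "nat \<Rightarrow> 'a \<Rightarrow> complex" where
    x: "\<And>n. norm (x n) = 1" "\<And>n. norm (S (x n)) \<le> e * (1 / 4) ^ Suc n"
    and f: "\<And>n. bounded_clinear (f n)" "\<And>n y. cmod (f n y) \<le> norm y"
    and diag: "\<And>n. f n (x n) = 1" and tri: "\<And>i n. i < n \<Longrightarrow> f i (x n) = 0"
    using infinitely_singular_small_sequence[OF sing e] by metis
  have coeff: "cmod (a n) \<le> 2 ^ n * norm (\<Sum>i<N. a i *\<^sub>C x i)" if "n < N" for a n N
    by (rule triangular_coefficient_bound[OF f x(1) diag _ that]) (rule tri)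
  define Y where "Y = closure (complex_vector.span (range x))"
  have sub: "complex_vector.subspace Y"
    unfolding Y_def by (intro subspace_closure complex_vector.subspace_span)
  have x_in: "x n \<in> Y" for n
    unfolding Y_def by (rule subsetD[OF closure_subset]) (simp add: complex_vector.span_base)
  have rep: "\<exists>a N. y = (\<Sum>i<N. a i *\<^sub>C x i)" if "y \<in> complex_vector.span (range x)" for y
  proof -
    have "\<exists>a N. (\<forall>i\<ge>N. a i = 0) \<and> y = (\<Sum>i<N. a i *\<^sub>C x i)"
      using that
    proof (induction rule: complex_vector.span_induct_alt)
      case base
      show ?case by (intro exI[of _ "\<lambda>_. 0"] exI[of _ 0]) simp
    next
      case (step c v y)
      then obtain k a N where v: "v = x k" and a: "\<And>i. i \<ge> N \<Longrightarrow> a i = 0" "y = (\<Sum>i<N. a i *\<^sub>C x i)"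
        by blast
      define N' where "N' = max N (Suc k)"
      have "y = (\<Sum>i<N'. a i *\<^sub>C x i)"
        unfolding a(2) N'_def by (rule sum.mono_neutral_left) (auto simp: a(1))
      moreover have "(\<Sum>i<N'. (a(k := a k + c)) i *\<^sub>C x i) =
          (\<Sum>i<N'. a i *\<^sub>C x i + (if i = k then c *\<^sub>C x k else 0))"
        by (intro sum.cong) (auto simp: scaleC_add_left)
      moreover have "(\<Sum>i<N'. if i = k then c *\<^sub>C x k else 0) = c *\<^sub>C v"
        by (simp add: N'_def v less_max_iff_disj)
      ultimately have "c *\<^sub>C v + y = (\<Sum>i<N'. (a(k := a k + c)) i *\<^sub>C x i)"
        by (simp only: sum.distrib add.commute)
      moreover have "\<forall>i\<ge>N'. (a(k := a k + c)) i = 0"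
        by (auto simp: N'_def a(1))
      ultimately show ?case by blast
    qed
    then show ?thesis by blast
  qed
  have small_span: "norm (S y) \<le> e * norm y" if y: "y \<in> complex_vector.span (range x)" for y
  proof -
    obtain a N where a: "y = (\<Sum>i<N. a i *\<^sub>C x i)" using rep[OF y] by blast
    have "norm (S y) \<le> (\<Sum>i<N. e * norm y * (1 / 2) ^ Suc i)"
      unfolding a bounded_clinear_sum[OF S] bounded_clinear_scaleC[OF S]
    proof (rule sum_norm_le)
      fix i assume "i \<in> {..<N}"
      then have "cmod (a i) * norm (S (x i)) \<le> (2 ^ i * norm y) * (e * (1 / 4) ^ Suc i)"
        unfolding a by (intro mult_mono coeff x(2)) auto
      also have "\<dots> = e * norm y * (2 ^ i * (1 / 4) ^ Suc i)" by simp
      also have "\<dots> \<le> e * norm y * (1 / 2) ^ Suc i"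
      proof (intro mult_left_mono)
        have "(2::real) ^ i * (1 / 4) ^ Suc i = (1 / 2) ^ Suc i / 2"
          by (simp add: power_mult_distrib[symmetric])
        then show "(2::real) ^ i * (1 / 4) ^ Suc i \<le> (1 / 2) ^ Suc i" by simp
      qed (use e in auto)
      finally show "norm (a i *\<^sub>C S (x i)) \<le> e * norm (\<Sum>i<N. a i *\<^sub>C x i) * (1 / 2) ^ Suc i"
        unfolding a norm_scaleC .
    qed
    also have "\<dots> = e * norm y * (\<Sum>i<N. (1 / 2) ^ Suc i)"
      by (simp only: sum_distrib_left)
    also have "\<dots> \<le> e * norm y * 1"
    proof (intro mult_left_mono)
      have "(\<Sum>i<N. (1 / 2 :: real) ^ Suc i) = 1 - (1 / 2) ^ N" by (induction N) auto
      then show "(\<Sum>i<N. (1 / 2 :: real) ^ Suc i) \<le> 1" by simp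
    qed (use e in auto)
    finally show ?thesis by simp
  qed
  have small: "norm (S y) \<le> e * norm y" if y: "y \<in> Y" for y
  proof -
    obtain u where u: "\<And>n. u n \<in> complex_vector.span (range x)" "u \<longlonglongrightarrow> y"
      using y unfolding Y_def closure_sequential by blast
    show ?thesis
      by (rule LIMSEQ_le[of "\<lambda>n. norm (S (u n))" _ "\<lambda>n. e * norm (u n)"])
        (use u small_span in \<open>auto intro!: tendsto_intros bounded_clinear_tendsto[OF S]\<close>)
  qed
  have "infinite_dimensional Y"
    unfolding infinite_dimensional_def
  proof
    assume "\<exists>B. finite B \<and> complex_vector.span B = Y"
    then obtain B where B: "finite B" "complex_vector.span B = Y" by blast
    have inj: "inj x"
    proof (rule linorder_injI)
      fix i j :: nat assume "i < j"
      then show "x i \<noteq> x j" using diag[of i] tri[of i j] by auto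
    qed
    define N where "N = Suc (card B)"
    have "complex_vector.independent (x ` {..<N})"
    proof (rule complex_vector.independent_if_scalars_zero)
      fix g v assume g: "(\<Sum>v\<in>x ` {..<N}. g v *\<^sub>C v) = 0" and v: "v \<in> x ` {..<N}"
      then obtain n where n: "n < N" "v = x n" by blast
      have "(\<Sum>i<N. g (x i) *\<^sub>C x i) = 0"
        using g by (subst (asm) sum.reindex) (auto intro: inj_on_subset[OF inj])
      then show "g v = 0"
        using coeff[OF n(1), of "\<lambda>i. g (x i)"] n(2) by simp
    qed simp
    moreover have "x ` {..<N} \<subseteq> complex_vector.span B"
      using B(2) x_in by blast
    ultimately have "card (x ` {..<N}) \<le> card B"
      using complex_vector.independent_span_bound[OF B(1)] by blast
    moreover have "card (x ` {..<N}) = N"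
      by (subst card_image) (auto intro: inj_on_subset[OF inj])
    ultimately show False by (simp add: N_def)
  qed
  then show ?thesis
    using that[OF sub _ _ small] by (simp add: Y_def)
qed

text \<open>For \<open>w = y + z\<close> the vector \<open>(\<alpha> - \<beta>) y\<close> equals \<open>(T - \<beta>) w - (T - \<alpha>) y - (T - \<beta>) z\<close>. The last
two terms are small, so \<open>y\<close> is controlled by \<open>w\<close>: the projection of \<open>Y + Z\<close> onto \<open>Y\<close> is bounded. This
makes the sum direct and closed.\<close>

lemma hereditarily_indecomposable_unique_singular_value:
  fixes T :: "'a::complex_banach \<Rightarrow> 'a"
  assumes HI: "hereditarily_indecomposable TYPE('a)" and T: "bounded_clinear T"
    and a: "infinitely_singular (\<lambda>x. T x - \<alpha> *\<^sub>C x)"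
    and b: "infinitely_singular (\<lambda>x. T x - \<beta> *\<^sub>C x)"
  shows "\<alpha> = \<beta>"
proof (rule ccontr)
  assume "\<alpha> \<noteq> \<beta>"
  define d where "d = cmod (\<alpha> - \<beta>)"
  have d: "d > 0" using \<open>\<alpha> \<noteq> \<beta>\<close> by (simp add: d_def)
  then have d4: "d / 4 > 0" by simp
  note bcl = bounded_clinear_sub_scaleC[OF T]
  obtain Y where Y: "complex_vector.subspace Y" "closed Y" "infinite_dimensional Y"
      "\<And>y. y \<in> Y \<Longrightarrow> norm (T y - \<alpha> *\<^sub>C y) \<le> d / 4 * norm y"
    using infinitely_singular_small_subspace[OF bcl a d4] by metis
  obtain Z where Z: "complex_vector.subspace Z" "closed Z" "infinite_dimensional Z"
      "\<And>z. z \<in> Z \<Longrightarrow> norm (T z - \<beta> *\<^sub>C z) \<le> d / 4 * norm z"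
    using infinitely_singular_small_subspace[OF bcl b d4] by metis
  obtain K where K: "K > 0" "\<And>x. norm (T x - \<beta> *\<^sub>C x) \<le> K * norm x"
    using bounded_clinear_bound[OF bcl] by metis
  define C where "C = (K + d / 4) / (d / 2)"
  have angle: "norm y \<le> C * norm (y + z)" if y: "y \<in> Y" and z: "z \<in> Z" for y z
  proof -
    define w where "w = y + z"
    have "(\<alpha> - \<beta>) *\<^sub>C y = (T w - \<beta> *\<^sub>C w) - (T y - \<alpha> *\<^sub>C y) - (T z - \<beta> *\<^sub>C z)"
      by (simp add: w_def bounded_clinear_add[OF T] scaleC_add_right complex_vector.scale_left_diff_distrib)
    then have "d * norm y \<le> norm (T w - \<beta> *\<^sub>C w) + norm (T y - \<alpha> *\<^sub>C y) + norm (T z - \<beta> *\<^sub>C z)"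
      unfolding d_def norm_scaleC[symmetric]
      by (metis (no_types, lifting) add_right_mono norm_triangle_ineq4 order_trans)
    then have "d * norm y \<le> K * norm w + d / 4 * norm y + d / 4 * norm z"
      using K(2)[of w] Y(4)[OF y] Z(4)[OF z] by linarith
    moreover have "d / 4 * norm z \<le> d / 4 * (norm w + norm y)"
      using norm_triangle_ineq4[of w y] d by (intro mult_left_mono) (auto simp: w_def)
    ultimately have "(d / 2) * norm y \<le> (K + d / 4) * norm w"
      by (simp add: algebra_simps)
    then show ?thesis using d by (simp add: C_def w_def field_simps)
  qed
  have "Y \<inter> Z = {0}"
  proof
    show "Y \<inter> Z \<subseteq> {0}"
    proof
      fix y assume "y \<in> Y \<inter> Z"
      then have "norm y \<le> C * norm (y + - y)"
        using angle[of y "- y"] complex_vector.subspace_neg[OF Z(1)] by blast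
      then show "y \<in> {0}" by simp
    qed
    show "{0} \<subseteq> Y \<inter> Z"
      using complex_vector.subspace_0 Y(1) Z(1) by blast
  qed
  moreover have "closed {y + z |y z. y \<in> Y \<and> z \<in> Z}"
    unfolding closed_sequential_limits
  proof (intro allI impI, elim conjE)
    fix w l assume w: "\<forall>n. w n \<in> {y + z |y z. y \<in> Y \<and> z \<in> Z}" and l: "w \<longlonglongrightarrow> l"
    then have "\<forall>n. \<exists>y z. y \<in> Y \<and> z \<in> Z \<and> w n = y + z" by blast
    then obtain y z where yz: "\<And>n. y n \<in> Y" "\<And>n. z n \<in> Z" "\<And>n. w n = y n + z n" by metis
    have C0: "C > 0" using K(1) d by (simp add: C_def)
    have "Cauchy y"
    proof (rule metric_CauchyI)
      fix r :: real assume r: "r > 0"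
      have "Cauchy w" using l by (rule LIMSEQ_imp_Cauchy)
      then obtain M where M: "\<And>m n. m \<ge> M \<Longrightarrow> n \<ge> M \<Longrightarrow> dist (w m) (w n) < r / C"
        using r C0 unfolding Cauchy_def by (meson divide_pos_pos)
      have "dist (y m) (y n) < r" if "m \<ge> M" "n \<ge> M" for m n
      proof -
        have "norm (y m - y n) \<le> C * norm ((y m - y n) + (z m - z n))"
          by (intro angle complex_vector.subspace_diff[OF Y(1)] complex_vector.subspace_diff[OF Z(1)] yz)
        also have "\<dots> = C * dist (w m) (w n)"
          by (simp add: dist_norm yz(3) algebra_simps)
        also have "\<dots> < C * (r / C)"
          using M[OF that] C0 by (intro mult_strict_left_mono)
        finally show ?thesis using C0 by (simp add: dist_norm)
      qed
      then show "\<exists>M. \<forall>m\<ge>M. \<forall>n\<ge>M. dist (y m) (y n) < r" by blast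
    qed
    then obtain y' where y': "y \<longlonglongrightarrow> y'" by (auto simp: Cauchy_convergent_iff convergent_def)
    have "(\<lambda>n. w n - y n) \<longlonglongrightarrow> l - y'" by (intro tendsto_diff l y')
    then have z: "z \<longlonglongrightarrow> l - y'" by (simp add: yz(3))
    have "l - y' \<in> Z" using closed_sequentially[OF Z(2) yz(2) z] .
    moreover have "y' \<in> Y" using closed_sequentially[OF Y(2) yz(1) y'] .
    ultimately show "l \<in> {y + z |y z. y \<in> Y \<and> z \<in> Z}"
      by (intro CollectI exI[of _ y'] exI[of _ "l - y'"]) simp
  qed
  ultimately show False
    using HI Y Z unfolding hereditarily_indecomposable_def by blast
qed

text \<open>The dual operator sends \<open>f\<close> to \<open>f \<circ> T\<close>.\<close>

definition no_dual_eigenvector :: "('a::complex_normed_vector \<Rightarrow> 'a) \<Rightarrow> bool"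
  where "no_dual_eigenvector T \<longleftrightarrow>
    (\<forall>(f :: 'a \<Rightarrow> complex) c. bounded_clinear f \<and> (\<forall>x. f (T x) = c * f x) \<longrightarrow> (\<forall>x. f x = 0))"

text \<open>Otherwise \<open>T - \<alpha>\<close> would have closed range. A functional vanishing on that range is an eigenvector of
the dual for \<open>\<alpha>\<close>, so the range is everything, and a frontier point at which \<open>T - \<alpha>\<close> is open and onto
is a point outside the spectrum.\<close>

lemma spectrum_frontier_infinitely_singular:
  fixes T :: "'a::complex_banach \<Rightarrow> 'a"
  assumes T: "bounded_clinear T" and no: "no_dual_eigenvector T"
    and a: "\<alpha> \<in> frontier (spectrum T)"
  shows "infinitely_singular (\<lambda>x. T x - \<alpha> *\<^sub>C x)"
proof (rule ccontr)
  define S where "S x = T x - \<alpha> *\<^sub>C x" for x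
  assume "\<not> infinitely_singular (\<lambda>x. T x - \<alpha> *\<^sub>C x)"
  then have "\<not> infinitely_singular S" by (simp add: S_def[abs_def])
  have S: "bounded_clinear S"
    unfolding S_def by (rule bounded_clinear_sub_scaleC[OF T])
  have UN: "complex_vector.subspace (UNIV :: 'a set)" by (rule complex_vector.subspace_UNIV)
  have op: "open_onto_image S UNIV"
    by (rule not_infinitely_singular_imp_open_onto_image) fact+
  have "range S = UNIV"
  proof (rule ccontr)
    assume "range S \<noteq> UNIV"
    then obtain x where "x \<notin> range S" by blast
    moreover have "closed (range S)"
      using open_onto_image_closed[OF S UN _ op] by simp
    ultimately have "x \<notin> closure (range S)" by simp
    then obtain f :: "'a \<Rightarrow> complex" where f: "bounded_clinear f" "\<And>y. y \<in> range S \<Longrightarrow> f y = 0" "f x \<noteq> 0"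
      using separating_functional[OF subspace_image[OF S UN]] by blast
    have "f (T y) = \<alpha> * f y" for y
      using f(2)[of "S y"]
      by (simp add: S_def bounded_clinear_diff[OF f(1)] bounded_clinear_scaleC[OF f(1)] scaleC_complex_def)
    then show False using no f(1,3) unfolding no_dual_eigenvector_def by blast
  qed
  then have "\<exists>C. \<forall>y. \<exists>x. S x = y \<and> norm x \<le> C * norm y"
    using op unfolding open_onto_image_def by (metis UNIV_I rangeE)
  then have "\<alpha> \<notin> spectrum T"
    using open_onto_in_closure_resolvent[OF T, of \<alpha>] a
    unfolding S_def by (auto simp: frontier_closures)
  moreover have "\<alpha> \<in> spectrum T"
    using a closed_spectrum[OF T] by (simp add: frontier_def)
  ultimately show False by blast
qed

text \<open>The plane without \<open>\<alpha>\<close> is connected; a set that contains one of its points but not \<open>\<mu>\<close> has a frontier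
point in it.\<close>

lemma subset_singleton_if_frontier_subset_singleton:
  fixes \<Sigma> :: "complex set"
  assumes fr: "frontier \<Sigma> \<subseteq> {\<alpha>}" and out: "\<mu> \<notin> \<Sigma>" "\<mu> \<noteq> \<alpha>"
  shows "\<Sigma> \<subseteq> {\<alpha>}"
proof (rule ccontr)
  assume "\<not> \<Sigma> \<subseteq> {\<alpha>}"
  then have "- {\<alpha>} \<inter> \<Sigma> \<noteq> {}" by blast
  moreover have "connected (- {\<alpha>})"
    by (intro path_connected_imp_connected path_connected_punctured_universe) simp
  ultimately have "- {\<alpha>} \<inter> frontier \<Sigma> \<noteq> {}"
    using out by (intro connected_Int_frontier) auto
  then show False using fr by blast
qed

lemma hereditarily_indecomposable_spectrum:
  fixes T :: "'a::complex_banach \<Rightarrow> 'a"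
  assumes HI: "hereditarily_indecomposable TYPE('a)" and T: "bounded_clinear T"
    and no: "no_dual_eigenvector T"
  obtains \<alpha> where "spectrum T \<subseteq> {\<alpha>}"
proof -
  obtain \<alpha> where fr: "frontier (spectrum T) \<subseteq> {\<alpha>}"
    using hereditarily_indecomposable_unique_singular_value[OF HI T]
      spectrum_frontier_infinitely_singular[OF T no] by blast
  obtain K where K: "\<And>\<mu>. cmod \<mu> > K \<Longrightarrow> \<mu> \<notin> spectrum T"
    using spectrum_bounded[OF T] by blast
  define \<mu> where "\<mu> = complex_of_real (\<bar>K\<bar> + cmod \<alpha> + 1)"
  have "cmod \<mu> = \<bar>K\<bar> + cmod \<alpha> + 1"
    unfolding \<mu>_def norm_of_real by simp
  then have "cmod \<mu> > K" "cmod \<mu> > cmod \<alpha>"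
    using norm_ge_zero[of \<alpha>] by linarith+
  then have "cmod \<mu> > K" "\<mu> \<noteq> \<alpha>" by auto
  then show ?thesis
    using that subset_singleton_if_frontier_subset_singleton[OF fr K] by blast
qed

section \<open>Newton series\<close>

text \<open>Equivalently, the power series with coefficients \<open>a\<close> has infinite radius of convergence. The form with
explicit constants is what gives the growth of the Newton series.\<close>

definition superexponential_decay :: "(nat \<Rightarrow> 'a::real_normed_vector) \<Rightarrow> bool"
  where "superexponential_decay a \<longleftrightarrow> (\<forall>\<epsilon>>0. \<exists>C. \<forall>k. norm (a k) \<le> C * \<epsilon> ^ k)"

definition newton_series :: "(nat \<Rightarrow> complex) \<Rightarrow> complex \<Rightarrow> complex"
  where "newton_series a z = (\<Sum>k. a k * (z gchoose k))"

text \<open>The right-hand side is \<open>x (x + 1) \<dots> (x + k - 1) / k!\<close>, written as a generalised binomial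
coefficient so that its generating function is the binomial series for the exponent \<open>- x\<close>.\<close>

lemma norm_gchoose_le:
  fixes z :: complex
  assumes "cmod z \<le> x"
  shows "cmod (z gchoose k) \<le> (- 1) ^ k * (- x gchoose k)"
proof -
  have "cmod (z gchoose k) = (\<Prod>i<k. cmod (- z + of_nat i)) / fact k"
    by (simp add: gbinomial_pochhammer pochhammer_prod norm_mult norm_divide norm_power
        prod_norm[symmetric] atLeast0LessThan)
  also have "\<dots> \<le> (\<Prod>i<k. x + of_nat i) / fact k"
  proof (intro divide_right_mono prod_mono conjI)
    fix i
    show "cmod (- z + of_nat i) \<le> x + of_nat i"
      using norm_triangle_ineq[of "- z" "of_nat i"] assms by simp
  qed auto
  also have "\<dots> = (- 1) ^ k * (- x gchoose k)"
    by (simp add: gbinomial_pochhammer pochhammer_prod atLeast0LessThan power_mult_distrib[symmetric])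
  finally show ?thesis .
qed

lemma gchoose_majorant_sums:
  fixes x \<epsilon> :: real
  assumes "0 < \<epsilon>" "\<epsilon> < 1"
  shows "(\<lambda>k. C * \<epsilon> ^ k * ((- 1) ^ k * (- x gchoose k))) sums (C * (1 - \<epsilon>) powr (- x))"
proof -
  have "(\<lambda>k. (- x gchoose k) * (- \<epsilon>) ^ k) sums (1 + - \<epsilon>) powr (- x)"
    by (rule gen_binomial_real) (use assms in auto)
  then have "(\<lambda>k. C * ((- x gchoose k) * (- \<epsilon>) ^ k)) sums (C * (1 + - \<epsilon>) powr (- x))"
    by (rule sums_mult)
  moreover have "(- \<epsilon>) ^ k = (- 1) ^ k * \<epsilon> ^ k" for k
    by (simp add: power_mult_distrib[symmetric])
  ultimately show ?thesis by (simp add: mult_ac)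
qed

lemma newton_term_le:
  fixes z :: complex
  assumes "\<And>k. norm (a k) \<le> C * \<epsilon> ^ k" "cmod z \<le> x"
  shows "cmod (a k * (z gchoose k)) \<le> C * \<epsilon> ^ k * ((- 1) ^ k * (- x gchoose k))"
  unfolding norm_mult
  using assms(1)[of k] norm_gchoose_le[OF assms(2), of k]
  by (intro mult_mono) (auto intro: order_trans[OF norm_ge_zero])

lemma newton_series_summable:
  fixes z :: complex
  assumes "superexponential_decay a"
  shows "summable (\<lambda>k. a k * (z gchoose k))"
proof -
  obtain C where C: "\<And>k. norm (a k) \<le> C * (1 / 2) ^ k"
    using assms unfolding superexponential_decay_def by (meson half_gt_zero_iff zero_less_one)
  have "summable (\<lambda>k. C * (1 / 2) ^ k * ((- 1) ^ k * (- cmod z gchoose k)))"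
    by (rule sums_summable[OF gchoose_majorant_sums]) auto
  then show ?thesis
    by (rule summable_comparison_test') (rule newton_term_le[OF C order_refl])
qed

text \<open>Coefficients bounded by \<open>C \<epsilon>\<^sup>k\<close> give the bound \<open>C (1 - \<epsilon>) powr (- \<bar>z\<bar>)\<close>. The choice
\<open>\<epsilon> = 1 - exp (- \<eta>)\<close> makes it \<open>C exp (\<eta> \<bar>z\<bar>)\<close>.\<close>

lemma newton_series_exponential_type_zero:
  assumes a: "superexponential_decay a" and eta: "\<eta> > 0"
  obtains C where "C > 0" "\<And>z. cmod (newton_series a z) \<le> C * exp (\<eta> * cmod z)"
proof -
  define \<epsilon> where "\<epsilon> = 1 - exp (- \<eta>)"
  have eps: "0 < \<epsilon>" "\<epsilon> < 1" using eta by (auto simp: \<epsilon>_def)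
  obtain C where C: "\<And>k. norm (a k) \<le> C * \<epsilon> ^ k"
    using a eps(1) unfolding superexponential_decay_def by blast
  have "cmod (newton_series a z) \<le> C * exp (\<eta> * cmod z)" for z
  proof -
    have "cmod (newton_series a z) \<le> (\<Sum>k. C * \<epsilon> ^ k * ((- 1) ^ k * (- cmod z gchoose k)))"
      unfolding newton_series_def
      by (intro norm_suminf_le newton_term_le[OF C] sums_summable[OF gchoose_majorant_sums[OF eps]]) simp
    also have "\<dots> = C * (1 - \<epsilon>) powr (- cmod z)"
      using gchoose_majorant_sums[OF eps] by (simp add: sums_iff)
    also have "(1 - \<epsilon>) powr (- cmod z) = exp (\<eta> * cmod z)"
      by (simp add: \<epsilon>_def powr_def)
    finally show ?thesis .
  qed
  then have "cmod (newton_series a z) \<le> (\<bar>C\<bar> + 1) * exp (\<eta> * cmod z)" for z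
    by (rule order_trans) (intro mult_right_mono, auto)
  then show ?thesis using that[of "\<bar>C\<bar> + 1"] by simp
qed

lemma newton_series_holomorphic:
  assumes a: "superexponential_decay a"
  shows "newton_series a holomorphic_on UNIV"
proof (rule holomorphic_uniform_sequence[of UNIV "\<lambda>n z. \<Sum>k<n. a k * (z gchoose k)"])
  show "(\<lambda>z. \<Sum>k<n. a k * (z gchoose k)) holomorphic_on UNIV" for n
    unfolding gbinomial_prod_rev by (intro holomorphic_intros) auto
next
  fix z :: complex
  obtain C where C: "\<And>k. norm (a k) \<le> C * (1 / 2) ^ k"
    using a unfolding superexponential_decay_def by (meson half_gt_zero_iff zero_less_one)
  have "uniform_limit (cball z 1) (\<lambda>n w. \<Sum>k<n. a k * (w gchoose k)) (newton_series a) sequentially"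
    unfolding newton_series_def
  proof (rule Weierstrass_m_test)
    fix k w assume "w \<in> cball z 1"
    then have "cmod w \<le> cmod z + 1"
      using norm_triangle_ineq2[of w z] by (simp add: dist_norm norm_minus_commute)
    then show "cmod (a k * (w gchoose k)) \<le> C * (1 / 2) ^ k * ((- 1) ^ k * (- (cmod z + 1) gchoose k))"
      by (rule newton_term_le[OF C])
  next
    show "summable (\<lambda>k. C * (1 / 2) ^ k * ((- 1) ^ k * (- (cmod z + 1) gchoose k)))"
      by (rule sums_summable[OF gchoose_majorant_sums]) auto
  qed
  then show "\<exists>d>0. cball z d \<subseteq> UNIV \<and>
      uniform_limit (cball z d) (\<lambda>n z. \<Sum>k<n. a k * (z gchoose k)) (newton_series a) sequentially"
    by (intro exI[of _ 1]) auto
qed simp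

lemma newton_series_of_nat:
  "newton_series a (of_nat n) = (\<Sum>k\<le>n. of_nat (n choose k) * a k)"
proof -
  have "newton_series a (of_nat n) = (\<Sum>k\<le>n. a k * (of_nat n gchoose k))"
    unfolding newton_series_def
    by (rule suminf_finite) (auto simp: binomial_gbinomial[symmetric] binomial_eq_0)
  then show ?thesis by (simp add: binomial_gbinomial mult.commute)
qed

lemma newton_series_real:
  fixes b :: "nat \<Rightarrow> real"
  assumes "superexponential_decay (\<lambda>k. complex_of_real (b k))"
  shows "newton_series (\<lambda>k. of_real (b k)) (of_real t) \<in> \<real>"
proof -
  have "Im (of_real (b k) * (complex_of_real t gchoose k)) = 0" for k
  proof -
    have "complex_of_real t gchoose k = of_real (t gchoose k)"
      by (simp add: gbinomial_prod_rev)
    then show ?thesis by simp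
  qed
  then have "Im (newton_series (\<lambda>k. of_real (b k)) (of_real t)) = 0"
    unfolding newton_series_def Im_suminf[OF newton_series_summable[OF assms]] by (simp only: suminf_zero)
  then show ?thesis by (simp add: complex_is_Real_iff)
qed

section \<open>Zeros of entire functions of exponential type zero\<close>

lemma entire_divide_out_zeros:
  assumes "finite Z" "F holomorphic_on UNIV" "\<And>t. t \<in> Z \<Longrightarrow> F t = 0"
  obtains H where "H holomorphic_on UNIV" "\<And>z :: complex. F z = H z * (\<Prod>t\<in>Z. z - t)"
proof -
  have "\<exists>H. H holomorphic_on UNIV \<and> (\<forall>z. F z = H z * (\<Prod>t\<in>Z. z - t))"
    using assms
  proof (induction Z rule: finite_induct)
    case (insert a Z)
    then obtain G where G: "G holomorphic_on UNIV" "\<And>z. F z = G z * (\<Prod>t\<in>Z. z - t)"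
      by auto
    have "(\<Prod>t\<in>Z. a - t) \<noteq> 0"
      using insert.hyps by (auto simp: prod_zero_iff)
    then have Ga: "G a = 0"
      using G(2)[of a] insert.prems(2)[of a] by simp
    define H where "H = (\<lambda>z. if z = a then deriv G a else (G z - G a) / (z - a))"
    have "H holomorphic_on UNIV"
      unfolding H_def by (rule pole_lemma[OF G(1)]) simp
    moreover have "F z = H z * (\<Prod>t\<in>insert a Z. z - t)" for z
      using G(2)[of z] Ga insert.hyps by (auto simp: H_def)
    ultimately show ?case by blast
  qed auto
  then show ?thesis using that by blast
qed

text \<open>A Jensen-type estimate. After division by the zeros, the maximum principle on the circle of
radius \<open>3 N\<close> applies: there each factor has modulus at least \<open>2 N\<close>, while at a point of \<open>{0..N}\<close> it has
modulus at most \<open>N\<close>, so every zero gains a factor \<open>1 / 2\<close>.\<close>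

lemma entire_many_zeros_bound:
  fixes F :: "complex \<Rightarrow> complex" and N :: real
  assumes F: "F holomorphic_on UNIV" and N: "N > 0"
    and Z: "finite Z" "Z \<subseteq> {0..N}" "\<And>t. t \<in> Z \<Longrightarrow> F (of_real t) = 0"
    and B: "\<And>z. cmod z = 3 * N \<Longrightarrow> cmod (F z) \<le> B" and s: "0 \<le> s" "s \<le> N"
  shows "cmod (F (of_real s)) \<le> B / 2 ^ card Z"
proof -
  define W where "W = complex_of_real ` Z"
  have W: "finite W" "\<And>t. t \<in> W \<Longrightarrow> F t = 0" "card W = card Z"
    using Z by (auto simp: W_def card_image inj_on_def)
  obtain H where H: "H holomorphic_on UNIV" "\<And>z. F z = H z * (\<Prod>t\<in>W. z - t)"
    using entire_divide_out_zeros[OF W(1) F W(2)] by metis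
  have B0: "B \<ge> 0"
    using B[of "of_real (3 * N)"] N norm_ge_zero order_trans by (metis abs_of_pos mult_pos_pos norm_of_real zero_less_numeral)
  have "cmod (H (of_real s)) \<le> B / (2 * N) ^ card Z"
  proof (rule maximum_modulus_frontier[of H "cball 0 (3 * N)"])
    fix z :: complex assume "z \<in> frontier (cball 0 (3 * N))"
    then have z: "cmod z = 3 * N" using N by (simp add: frontier_cball)
    have "(\<Prod>t\<in>W. 2 * N) \<le> (\<Prod>t\<in>W. cmod (z - t))"
    proof (intro prod_mono conjI)
      fix t assume "t \<in> W"
      then have "cmod t \<le> N" using Z(2) by (auto simp: W_def)
      then show "2 * N \<le> cmod (z - t)"
        using norm_triangle_ineq2[of z t] z by simp
    qed (use N in auto)
    then have "(2 * N) ^ card Z \<le> cmod (\<Prod>t\<in>W. z - t)"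
      by (simp add: W(3) prod_norm)
    then have "cmod (H z) * (2 * N) ^ card Z \<le> cmod (F z)"
      unfolding H(2)[of z] norm_mult by (intro mult_left_mono) auto
    then have "cmod (H z) * (2 * N) ^ card Z \<le> B"
      using B[OF z] by simp
    then show "cmod (H z) \<le> B / (2 * N) ^ card Z"
      using N by (simp add: field_simps)
  qed (use H(1) s N in \<open>auto intro: holomorphic_on_subset holomorphic_on_imp_continuous_on\<close>)
  moreover have "cmod (\<Prod>t\<in>W. of_real s - t) \<le> N ^ card Z"
  proof -
    have "cmod (\<Prod>t\<in>W. of_real s - t) = (\<Prod>t\<in>W. cmod (of_real s - t))"
      by (simp add: prod_norm)
    also have "\<dots> \<le> (\<Prod>t\<in>W. N)"
    proof (intro prod_mono conjI)
      fix t assume "t \<in> W"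
      then obtain t' where t': "t = of_real t'" "0 \<le> t'" "t' \<le> N" using Z(2) by (auto simp: W_def)
      have "cmod (of_real s - t) = \<bar>s - t'\<bar>"
        unfolding t' of_real_diff[symmetric] norm_of_real by simp
      then show "cmod (of_real s - t) \<le> N" using s t' by simp
    qed auto
    finally show ?thesis by (simp add: W(3))
  qed
  ultimately have "cmod (F (of_real s)) \<le> (B / (2 * N) ^ card Z) * N ^ card Z"
    unfolding H(2)[of "of_real s"] norm_mult using B0 N by (intro mult_mono) auto
  also have "\<dots> = B / 2 ^ card Z"
    using N by (simp add: power_mult_distrib)
  finally show ?thesis .
qed

text \<open>With more than \<open>\<delta> N\<close> zeros the estimate above yields \<open>C exp (3 \<eta> N) / 2 powr (\<delta> N)\<close> as a bound at the
fixed point \<open>s\<close>. The choice \<open>\<eta> = \<delta> ln 2 / 6\<close> makes this \<open>C exp (- 3 \<eta> N)\<close>, which eventually drops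
below the modulus of the value at \<open>s\<close>.\<close>

lemma entire_type_zero_few_real_zeros:
  fixes F :: "complex \<Rightarrow> complex"
  assumes F: "F holomorphic_on UNIV"
    and type: "\<And>\<eta>. \<eta> > 0 \<Longrightarrow> \<exists>C>0. \<forall>z. cmod (F z) \<le> C * exp (\<eta> * cmod z)"
    and s: "s \<ge> 0" "F (of_real s) \<noteq> 0" and delta: "\<delta> > 0"
  shows "\<forall>\<^sub>F N in at_top. \<forall>Z. finite Z \<and> Z \<subseteq> {0..N} \<and> (\<forall>t\<in>Z. F (of_real t) = 0) \<longrightarrow> real (card Z) \<le> \<delta> * N"
proof -
  define \<eta> where "\<eta> = \<delta> * ln 2 / 6"
  have eta: "\<eta> > 0" using delta by (simp add: \<eta>_def)
  obtain C where C: "C > 0" "\<And>z. cmod (F z) \<le> C * exp (\<eta> * cmod z)"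
    using type[OF eta] by blast
  have "((\<lambda>N. C * exp (- (3 * \<eta>) * N)) \<longlongrightarrow> C * 0) at_top"
    by (intro tendsto_mult_left filterlim_compose[OF exp_at_bot]
        filterlim_tendsto_neg_mult_at_bot[OF tendsto_const]) (use eta in \<open>auto intro: filterlim_ident\<close>)
  then have "\<forall>\<^sub>F N in at_top. C * exp (- (3 * \<eta>) * N) < cmod (F (of_real s))"
    using s(2) by (intro order_tendstoD(2)) auto
  then show ?thesis
    using eventually_gt_at_top[of 0] eventually_ge_at_top[of s]
  proof eventually_elim
    case (elim N)
    show ?case
    proof (intro allI impI, elim conjE)
      fix Z assume Z: "finite Z" "Z \<subseteq> {0..N}" "\<forall>t\<in>Z. F (of_real t) = 0"
      show "real (card Z) \<le> \<delta> * N"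
      proof (rule ccontr)
        assume "\<not> real (card Z) \<le> \<delta> * N"
        then have card: "6 * \<eta> * N \<le> real (card Z) * ln 2"
          using mult_right_mono[of "\<delta> * N" "real (card Z)" "ln 2"] by (simp add: \<eta>_def mult_ac)
        have "cmod (F (of_real s)) \<le> (C * exp (\<eta> * (3 * N))) / 2 ^ card Z"
        proof (rule entire_many_zeros_bound[OF F elim(2) Z(1,2) _ _ s(1) elim(3)])
          show "cmod (F z) \<le> C * exp (\<eta> * (3 * N))" if "cmod z = 3 * N" for z
            using C(2)[of z] that by simp
        qed (use Z in auto)
        also have "(2::real) ^ card Z = exp (real (card Z) * ln 2)"
          by (simp add: exp_of_nat_mult)
        also have "(C * exp (\<eta> * (3 * N))) / exp (real (card Z) * ln 2)
            \<le> (C * exp (\<eta> * (3 * N))) / exp (6 * \<eta> * N)"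
          using card C(1) by (intro divide_left_mono) auto
        also have "\<dots> = C * exp (- (3 * \<eta>) * N)"
          unfolding times_divide_eq_right[symmetric] exp_diff[symmetric] by (simp add: algebra_simps)
        finally show False using elim(1) by simp
      qed
    qed
  qed
qed

section \<open>Binomial transforms oscillate rarely\<close>

text \<open>Witnesses in the gaps between consecutive elements are distinct; the largest element has no gap after it.\<close>

lemma separated_set_card_le:
  fixes A :: "nat set" and P :: "real \<Rightarrow> bool"
  assumes "finite A" "\<And>n m. n \<in> A \<Longrightarrow> m \<in> A \<Longrightarrow> n < m \<Longrightarrow> \<exists>t. real n < t \<and> t < real m \<and> P t"
  shows "\<exists>Z. finite Z \<and> (\<forall>t\<in>Z. P t \<and> 0 \<le> t \<and> (\<exists>m\<in>A. t < real m)) \<and> card A \<le> card Z + 1"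
  using assms
proof (induction A rule: finite_linorder_max_induct)
  case empty
  show ?case by (intro exI[of _ "{}"]) simp
next
  case (insert b A)
  obtain Z where Z: "finite Z" "\<And>t. t \<in> Z \<Longrightarrow> P t \<and> 0 \<le> t \<and> (\<exists>m\<in>A. t < real m)" "card A \<le> card Z + 1"
    using insert.IH insert.prems by (metis insertCI)
  show ?case
  proof (cases "A = {}")
    case True
    then show ?thesis by (intro exI[of _ "{}"]) simp
  next
    case False
    define m where "m = Max A"
    have m: "m \<in> A" "\<And>n. n \<in> A \<Longrightarrow> n \<le> m" using False insert.hyps by (auto simp: m_def)
    obtain t where t: "real m < t" "t < real b" "P t"
      using insert.prems[of m b] m insert.hyps by auto
    have "t \<notin> Z"
    proof
      assume "t \<in> Z"
      then obtain n where "n \<in> A" "t < real n" using Z(2) by blast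
      then show False using m(2)[of n] t(1) by simp
    qed
    then have "card (insert t Z) = card Z + 1" using Z(1) by simp
    moreover have "card (insert b A) = card A + 1" using insert.hyps by auto
    moreover have "0 \<le> t" using t(1) of_nat_0_le_iff[of m] by linarith
    ultimately show ?thesis
      using Z t by (intro exI[of _ "insert t Z"]) auto
  qed
qed

definition binomial_transform :: "(nat \<Rightarrow> 'a::comm_semiring_1) \<Rightarrow> nat \<Rightarrow> 'a"
  where "binomial_transform a n = (\<Sum>k\<le>n. of_nat (n choose k) * a k)"

lemma binomial_transform_Suc:
  "binomial_transform a (Suc n) = binomial_transform a n + binomial_transform (\<lambda>k. a (Suc k)) n"
proof -
  have "binomial_transform a (Suc n) =
      a 0 + (\<Sum>k\<le>n. of_nat (n choose Suc k) * a (Suc k) + of_nat (n choose k) * a (Suc k))"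
    unfolding binomial_transform_def by (subst sum.atMost_Suc_shift) (simp add: algebra_simps)
  also have "\<dots> = (a 0 + (\<Sum>k\<le>n. of_nat (n choose Suc k) * a (Suc k)))
      + binomial_transform (\<lambda>k. a (Suc k)) n"
    by (simp add: sum.distrib binomial_transform_def algebra_simps)
  also have "a 0 + (\<Sum>k\<le>n. of_nat (n choose Suc k) * a (Suc k)) = (\<Sum>k\<le>Suc n. of_nat (n choose k) * a k)"
    by (subst sum.atMost_Suc_shift) simp
  also have "\<dots> = binomial_transform a n"
    by (simp add: binomial_transform_def binomial_eq_0)
  finally show ?thesis .
qed

text \<open>The Newton series interpolates the binomial transform at the integers and is real on the real
axis, so each sign change produces a real zero of a function of exponential type zero.\<close>

lemma binomial_transform_few_sign_changes:
  fixes b :: "nat \<Rightarrow> real"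
  assumes b: "superexponential_decay b" and n0: "binomial_transform b n0 \<noteq> 0" and delta: "\<delta> > 0"
    and sep: "\<And>n m. n \<in> A \<Longrightarrow> m \<in> A \<Longrightarrow> n < m \<Longrightarrow>
      \<exists>i j. n \<le> i \<and> i < j \<and> j \<le> m \<and> binomial_transform b i * binomial_transform b j < 0"
  shows "\<forall>\<^sub>F N in sequentially. real (card {m \<in> A. m \<le> N}) \<le> \<delta> * real N + 1"
proof -
  define F where "F = newton_series (\<lambda>k. complex_of_real (b k))"
  have decay: "superexponential_decay (\<lambda>k. complex_of_real (b k))"
    using b by (simp add: superexponential_decay_def)
  have F_nat: "F (of_nat n) = of_real (binomial_transform b n)" for n
    by (simp add: F_def newton_series_of_nat binomial_transform_def)
  have hol: "F holomorphic_on UNIV"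
    unfolding F_def by (rule newton_series_holomorphic[OF decay])
  have type: "\<exists>C>0. \<forall>z. cmod (F z) \<le> C * exp (\<eta> * cmod z)" if "\<eta> > 0" for \<eta>
    using newton_series_exponential_type_zero[OF decay that] unfolding F_def by metis
  have cont: "continuous_on S (\<lambda>t. Re (F (of_real t)))" for S
    by (intro continuous_intros continuous_on_compose2[OF holomorphic_on_imp_continuous_on[OF hol]]) auto
  have zero: "\<exists>t. real n < t \<and> t < real m \<and> F (of_real t) = 0" if nm: "n \<in> A" "m \<in> A" "n < m" for n m
  proof -
    obtain i j where ij: "n \<le> i" "i < j" "j \<le> m" "binomial_transform b i * binomial_transform b j < 0"
      using sep[OF nm] by blast
    define R where "R t = Re (F (of_real t))" for t
    have R: "R (real k) = binomial_transform b k" for k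
      using F_nat[of k] by (simp add: R_def)
    have R_cont: "continuous_on {real i..real j} R"
      unfolding R_def by (rule cont)
    have "\<exists>t. real i \<le> t \<and> t \<le> real j \<and> R t = 0"
    proof (cases "R (real i) \<le> 0")
      case True
      then show ?thesis
        using ij R R_cont by (intro IVT') (auto simp: mult_less_0_iff)
    next
      case False
      then show ?thesis
        using ij R R_cont by (intro IVT2') (auto simp: mult_less_0_iff)
    qed
    then obtain t where t: "real i \<le> t" "t \<le> real j" "R t = 0" by blast
    have "t \<noteq> real i" "t \<noteq> real j" using R ij(4) t(3) by auto
    moreover have "F (of_real t) = 0"
      using t(3) newton_series_real[OF decay, of t]
      by (simp add: R_def F_def complex_is_Real_iff complex_eq_iff)
    ultimately show ?thesis using t ij by (intro exI[of _ t]) auto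
  qed
  have "\<forall>\<^sub>F N in at_top. \<forall>Z. finite Z \<and> Z \<subseteq> {0..N} \<and> (\<forall>t\<in>Z. F (of_real t) = 0) \<longrightarrow> real (card Z) \<le> \<delta> * N"
    by (rule entire_type_zero_few_real_zeros[OF hol type, of "real n0"]) (use n0 F_nat delta in auto)
  then have "\<forall>\<^sub>F N in sequentially. \<forall>Z. finite Z \<and> Z \<subseteq> {0..real N} \<and> (\<forall>t\<in>Z. F (of_real t) = 0) \<longrightarrow>
      real (card Z) \<le> \<delta> * real N"
    using filterlim_real_sequentially by (rule eventually_compose_filterlim)
  then show ?thesis
  proof eventually_elim
    case (elim N)
    have "\<exists>Z. finite Z \<and> (\<forall>t\<in>Z. F (of_real t) = 0 \<and> 0 \<le> t \<and> (\<exists>m\<in>{m \<in> A. m \<le> N}. t < real m)) \<and>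
        card {m \<in> A. m \<le> N} \<le> card Z + 1"
      by (rule separated_set_card_le) (use zero in simp_all)
    then obtain Z where Z: "finite Z" "\<And>t. t \<in> Z \<Longrightarrow> F (of_real t) = 0 \<and> 0 \<le> t \<and> (\<exists>m\<in>{m \<in> A. m \<le> N}. t < real m)"
        "card {m \<in> A. m \<le> N} \<le> card Z + 1"
      by blast
    have "Z \<subseteq> {0..real N}" using Z(2) by fastforce
    then have "real (card Z) \<le> \<delta> * real N" using elim Z by blast
    then show ?case using Z(3) by linarith
  qed
qed

text \<open>Suppose that \<open>n < m\<close> lie in \<open>A\<close> and that the differences of \<open>u\<close> keep their sign from \<open>n\<close> up to \<open>m\<close>. After
the jump, \<open>u\<close> exceeds \<open>2 \<rho>\<^sup>n - \<rho>\<^sup>n = \<rho>\<^sup>n \<ge> \<rho>\<^sup>m\<close> in the direction of the jump, and by monotonicity it still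
does so at \<open>m\<close>, contradicting the smallness there. So any two elements of \<open>A\<close> are
separated by a sign change of the differences, which are again a binomial transform.\<close>

lemma binomial_transform_rare_jumps:
  fixes a :: "nat \<Rightarrow> real" and \<rho> :: real
  assumes a: "superexponential_decay a" and rho: "0 < \<rho>" "\<rho> \<le> 1" and delta: "\<delta> > 0"
  defines "u \<equiv> binomial_transform a"
  defines "A \<equiv> {n. \<bar>u n\<bar> < \<rho> ^ n \<and> \<bar>u (Suc n) - u n\<bar> > 2 * \<rho> ^ n}"
  shows "\<forall>\<^sub>F N in sequentially. real (card {m \<in> A. m \<le> N}) \<le> \<delta> * real N + 1"
proof -
  define b where "b k = a (Suc k)" for k
  define d where "d = binomial_transform b"
  have b: "superexponential_decay b"
    unfolding superexponential_decay_def
  proof (intro allI impI)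
    fix \<epsilon> :: real assume "\<epsilon> > 0"
    then obtain C where C: "\<And>k. norm (a k) \<le> C * \<epsilon> ^ k"
      using a unfolding superexponential_decay_def by blast
    show "\<exists>C. \<forall>k. norm (b k) \<le> C * \<epsilon> ^ k"
      using C[of "Suc _"] by (intro exI[of _ "C * \<epsilon>"]) (simp add: b_def mult.assoc)
  qed
  have d: "u (Suc n) = u n + d n" for n
    unfolding u_def d_def b_def[abs_def] by (rule binomial_transform_Suc)
  have sep: "\<exists>i j. n \<le> i \<and> i < j \<and> j \<le> m \<and> d i * d j < 0" if nm: "n \<in> A" "m \<in> A" "n < m" for n m
  proof (rule ccontr)
    assume no: "\<not> ?thesis"
    have n: "\<bar>u n\<bar> < \<rho> ^ n" "\<bar>d n\<bar> > 2 * \<rho> ^ n" and m: "\<bar>u m\<bar> < \<rho> ^ m"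
      using nm d[of n] by (auto simp: A_def)
    have "\<rho> ^ m \<le> \<rho> ^ n" using rho nm(3) by (intro power_decreasing) auto
    have pos: "\<rho> ^ n > 0" using rho by simp
    \<comment> \<open>Multiplying by the sign of the jump treats increasing and decreasing stretches at once.\<close>
  have mono: "sgn (d n) * u (Suc n) \<le> sgn (d n) * u (Suc n + l)" if "Suc n + l \<le> m" for l
      using that
    proof (induction l)
      case (Suc l)
      have "\<not> d n * d (Suc n + l) < 0"
      proof
        assume "d n * d (Suc n + l) < 0"
        moreover have "n \<le> n" "n < Suc n + l" "Suc n + l \<le> m" using Suc.prems by simp_all
        ultimately show False using no by blast
      qed
      then have "0 \<le> sgn (d n) * d (Suc n + l)"
        by (auto simp: sgn_if zero_le_mult_iff mult_less_0_iff not_less)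
      then show ?case using Suc d[of "Suc n + l"] by (simp add: algebra_simps)
    qed simp
    have "sgn (d n) * u (Suc n) \<le> sgn (d n) * u m"
      using mono[of "m - Suc n"] nm(3) by simp
    moreover have "sgn (d n) * u (Suc n) = sgn (d n) * u n + \<bar>d n\<bar>"
      by (simp add: d algebra_simps linordered_idom_class.abs_sgn)
    moreover have "d n \<noteq> 0" using n(2) pos by linarith
    then have "sgn (d n) = 1 \<or> sgn (d n) = - 1" by (simp add: sgn_if)
    ultimately show False
      using n m pos \<open>\<rho> ^ m \<le> \<rho> ^ n\<close> by auto
  qed
  show ?thesis
  proof (cases "\<exists>n0. d n0 \<noteq> 0")
    case True
    then show ?thesis
      using binomial_transform_few_sign_changes[OF b, folded d_def, of _ \<delta> A] sep delta by blast
  next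
    case False
    then have "A = {}"
      using d rho by (auto simp: A_def not_less intro: less_imp_le)
    then show ?thesis using delta by simp
  qed
qed

section \<open>Upper density and hypercyclic orbits\<close>

lemma upper_density_nonpos:
  assumes "\<And>\<delta>. \<delta> > 0 \<Longrightarrow> \<forall>\<^sub>F N in sequentially. real (card {m \<in> A. m \<le> N}) \<le> \<delta> * real N + c"
  shows "upper_density A \<le> 0"
proof (rule ereal_le_epsilon2)
  fix e :: real assume e: "e > 0"
  have "\<forall>\<^sub>F N in sequentially. real (card {m \<in> A. m \<le> N}) \<le> (e / 2) * real N + c"
    using assms[of "e / 2"] e by simp
  moreover have "\<forall>\<^sub>F N in sequentially. real N \<ge> 2 * \<bar>c\<bar> / e + 1"
    using filterlim_real_sequentially unfolding filterlim_at_top by blast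
  ultimately have "\<forall>\<^sub>F N in sequentially. ereal (real (card {m \<in> A. m \<le> N}) / real N) \<le> ereal e"
  proof eventually_elim
    case (elim N)
    have "2 * \<bar>c\<bar> / e \<ge> 0" using e by simp
    then have N: "real N > 0" using elim(2) by linarith
    have "2 * \<bar>c\<bar> \<le> e * real N" using elim(2) e by (simp add: field_simps)
    then have "real (card {m \<in> A. m \<le> N}) \<le> e * real N" using elim(1) by (simp add: field_simps)
    then show ?case using N by (simp add: field_simps)
  qed
  then have "upper_density A \<le> ereal e"
    unfolding upper_density_def by (rule Limsup_bounded)
  then show "upper_density A \<le> 0 + ereal e" by simp
qed

lemma lower_density_le_upper_density: "lower_density A \<le> upper_density A"
  unfolding lower_density_def upper_density_def by (intro Liminf_le_Limsup) simp

lemma frequently_imp_u_frequently_hypercyclic: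
  assumes "frequently_hypercyclic T"
  shows "u_frequently_hypercyclic T"
proof -
  obtain x where x: "\<And>U. open U \<Longrightarrow> U \<noteq> {} \<Longrightarrow> lower_density {n. n > 0 \<and> (T ^^ n) x \<in> U} > 0"
    using assms unfolding frequently_hypercyclic_def by blast
  show ?thesis
    unfolding u_frequently_hypercyclic_def
  proof (intro exI[of _ x] allI impI, elim conjE)
    show "upper_density {n. n > 0 \<and> (T ^^ n) x \<in> U} > 0" if "open U" "U \<noteq> {}" for U
      using x[OF that] lower_density_le_upper_density by (rule less_le_trans)
  qed
qed

lemma positive_upper_density_nonempty:
  assumes "upper_density A > 0"
  shows "\<exists>n. n \<in> A"
proof (rule ccontr)
  assume "\<nexists>n. n \<in> A"
  then have "upper_density A \<le> 0"
    by (intro upper_density_nonpos[where c = 0]) simp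
  then show False using assms by simp
qed

lemma funpow_bounded_clinear:
  fixes T :: "'a::complex_normed_vector \<Rightarrow> 'a"
  assumes "bounded_clinear T"
  shows "bounded_clinear (T ^^ n)"
proof (induction n)
  case 0
  have "T ^^ 0 = (\<lambda>x. 1 *\<^sub>C x)" by (rule ext) (simp add: scaleC_one)
  then show ?case by (simp only: bounded_clinear_scaleC_map)
next
  case (Suc n)
  have "T ^^ Suc n = (\<lambda>x. T ((T ^^ n) x))" by (rule ext) simp
  then show ?case by (simp only: bounded_clinear_compose[OF assms Suc])
qed

lemma nonzero_functional_onto:
  fixes f :: "'a::complex_normed_vector \<Rightarrow> complex"
  assumes f: "bounded_clinear f" and v: "f v \<noteq> 0"
  shows "\<exists>u. f u = c"
  using v by (intro exI[of _ "(c / f v) *\<^sub>C v"]) (simp add: bounded_clinear_scaleC[OF f] scaleC_complex_def)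

lemma open_norm_functional:
  fixes f :: "'a::complex_normed_vector \<Rightarrow> complex"
  assumes f: "bounded_clinear f"
  shows "open {u. r < cmod (f u)}" "open {u. cmod (f u) < r}"
proof -
  have "continuous_on UNIV f"
    by (simp add: assms bounded_clinear_imp_bounded_linear linear_continuous_on)
  then show "open {u. r < cmod (f u)}" "open {u. cmod (f u) < r}"
    by (auto intro!: open_Collect_less continuous_intros)
qed

text \<open>Along the orbit an eigenvector \<open>f\<close> of the dual takes the values \<open>c\<^sup>n f x\<close>, whose moduli either stay
at most \<open>\<bar>f x\<bar>\<close> or stay at least \<open>\<bar>f x\<bar>\<close>. Unless \<open>f = 0\<close>, the first excludes an open set far out and the second a neighbourhood of \<open>0\<close>.\<close>

lemma dense_orbit_no_dual_eigenvector:
  fixes T :: "'a::complex_normed_vector \<Rightarrow> 'a"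
  assumes dense: "\<And>U. open U \<Longrightarrow> U \<noteq> {} \<Longrightarrow> \<exists>n. (T ^^ n) x \<in> U"
  shows "no_dual_eigenvector T"
  unfolding no_dual_eigenvector_def
proof (intro allI impI, elim conjE)
  fix f :: "'a \<Rightarrow> complex" and c v
  assume f: "bounded_clinear f" and eig: "\<forall>x. f (T x) = c * f x"
  have orbit: "f ((T ^^ n) x) = c ^ n * f x" for n
    by (induction n) (use eig in auto)
  show "f v = 0"
  proof (rule ccontr)
    assume v: "f v \<noteq> 0"
    obtain u where u: "f u = of_real (cmod (f x) + 1)"
      using nonzero_functional_onto[OF f v] by metis
    have "cmod (f u) = cmod (f x) + 1"
      unfolding u norm_of_real by simp
    then have "{u. cmod (f x) < cmod (f u)} \<noteq> {}"
      by (metis (mono_tags) empty_iff less_add_one mem_Collect_eq)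
    then obtain n where n: "cmod (f x) < cmod (c ^ n * f x)"
      using dense[OF open_norm_functional(1)[OF f]] orbit by fastforce
    then have fx: "f x \<noteq> 0" by auto
    have c: "cmod c > 1"
    proof (rule ccontr)
      assume "\<not> cmod c > 1"
      then have "cmod c ^ n * cmod (f x) \<le> 1 * cmod (f x)"
        by (intro mult_right_mono power_le_one) auto
      then show False using n by (simp add: norm_mult norm_power)
    qed
    have "0 \<in> {u. cmod (f u) < cmod (f x)}"
      using fx by (simp add: bounded_clinear_zero[OF f])
    then obtain m where "cmod (c ^ m * f x) < cmod (f x)"
      using dense[OF open_norm_functional(2)[OF f]] orbit by fastforce
    moreover have "1 * cmod (f x) \<le> cmod c ^ m * cmod (f x)"
      using c by (intro mult_right_mono one_le_power) auto
    ultimately show False by (simp add: norm_mult norm_power)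
  qed
qed

section \<open>Operators with at most one spectral value\<close>

text \<open>For \<open>u \<noteq> 0\<close> the operator \<open>1 - u (T - c)\<close> is \<open>- u\<close> times \<open>T - (c + 1 / u)\<close>. As \<open>u\<close> varies, this turns
the resolvent outside of \<open>c\<close> into the function expanded in \<open>orbit_power_series\<close>.\<close>

lemma has_bounded_inverse_if_not_in_spectrum:
  fixes T :: "'a::complex_banach \<Rightarrow> 'a"
  assumes u: "u = 0 \<or> c + 1 / u \<notin> spectrum T"
  shows "has_bounded_inverse (\<lambda>x. x - u *\<^sub>C (T x - c *\<^sub>C x))"
proof (cases "u = 0")
  case True
  have "bounded_clinear (\<lambda>x :: 'a. x)"
    using bounded_clinear_scaleC_map[of 1] by (simp add: scaleC_one)
  then show ?thesis
    unfolding True has_bounded_inverse_def by (intro exI[of _ "\<lambda>x. x"]) simp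
next
  case False
  obtain R where R: "bounded_clinear R" "\<And>x. R (T x - (c + 1 / u) *\<^sub>C x) = x"
      "\<And>x. T (R x) - (c + 1 / u) *\<^sub>C R x = x"
    using u False unfolding spectrum_def has_bounded_inverse_def by auto
  have eq: "x - u *\<^sub>C (T x - c *\<^sub>C x) = (- u) *\<^sub>C (T x - (c + 1 / u) *\<^sub>C x)" for x
    using False
    by (simp add: complex_vector.scale_right_diff_distrib scaleC_add_left scaleC_add_right
        scaleC_scaleC scaleC_one distrib_left)
  define R' where "R' y = R ((- 1 / u) *\<^sub>C y)" for y
  have "bounded_clinear R'"
    unfolding R'_def by (intro bounded_clinear_compose[OF R(1)] bounded_clinear_scaleC_map)
  moreover have "R' (x - u *\<^sub>C (T x - c *\<^sub>C x)) = x" for x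
  proof -
    have "(- 1 / u) *\<^sub>C (x - u *\<^sub>C (T x - c *\<^sub>C x)) = T x - (c + 1 / u) *\<^sub>C x"
      unfolding eq scaleC_scaleC using False by (simp add: scaleC_one)
    then show ?thesis unfolding R'_def by (simp only: R(2))
  qed
  moreover have "R' x - u *\<^sub>C (T (R' x) - c *\<^sub>C R' x) = x" for x
    unfolding eq R'_def R(3) scaleC_scaleC using False by (simp add: scaleC_one)
  ultimately show ?thesis
    unfolding has_bounded_inverse_def by blast
qed

lemma superexponential_decay_if_entire:
  fixes a :: "nat \<Rightarrow> complex"
  assumes "\<And>w. summable (\<lambda>n. a n * w ^ n)"
  shows "superexponential_decay a"
  unfolding superexponential_decay_def
proof (intro allI impI)
  fix \<epsilon> :: real assume eps: "\<epsilon> > 0"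
  have "(\<lambda>n. a n * of_real (1 / \<epsilon>) ^ n) \<longlonglongrightarrow> 0"
    by (intro summable_LIMSEQ_zero assms)
  then have "Bseq (\<lambda>n. a n * of_real (1 / \<epsilon>) ^ n)"
    by (intro convergent_imp_Bseq convergentI)
  then obtain C where C: "\<And>n. norm (a n * of_real (1 / \<epsilon>) ^ n) \<le> C"
    unfolding Bseq_def by blast
  have "norm (a n) \<le> C * \<epsilon> ^ n" for n
    using C[of n] eps by (simp add: norm_mult norm_power norm_divide power_divide field_simps)
  then show "\<exists>C. \<forall>n. norm (a n) \<le> C * \<epsilon> ^ n" by blast
qed

text \<open>The binomial formula for the powers of \<open>1 + Q\<close>. The induction moves one factor onto the vector, and
Pascal's rule for the transform does the rest.\<close>

lemma funpow_binomial_transform: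
  fixes Q :: "'a::complex_normed_vector \<Rightarrow> 'a" and f :: "'a \<Rightarrow> complex"
  assumes P: "bounded_clinear P" and f: "bounded_clinear f" and PQ: "\<And>x. P x = x + Q x"
  shows "f ((P ^^ n) x) = binomial_transform (\<lambda>k. f ((Q ^^ k) x)) n"
proof (induction n arbitrary: x)
  case 0
  show ?case by (simp add: binomial_transform_def)
next
  case (Suc n)
  have "f ((P ^^ Suc n) x) = f ((P ^^ n) (x + Q x))"
    by (simp add: funpow_swap1 PQ)
  also have "\<dots> = f ((P ^^ n) x) + f ((P ^^ n) (Q x))"
    by (simp add: bounded_clinear_add[OF funpow_bounded_clinear[OF P]] bounded_clinear_add[OF f])
  also have "\<dots> = binomial_transform (\<lambda>k. f ((Q ^^ k) x)) (Suc n)"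
    by (simp add: Suc binomial_transform_Suc funpow_swap1)
  finally show ?case .
qed

text \<open>A complex jump of size \<open>4 \<rho>\<^sup>n\<close> shows up as a jump of size \<open>2 \<rho>\<^sup>n\<close> in the real or in the imaginary
part, so two applications of the real case suffice.\<close>

lemma complex_binomial_transform_rare_jumps:
  fixes q :: "nat \<Rightarrow> complex" and \<rho> :: real
  assumes q: "superexponential_decay q" and rho: "0 < \<rho>" "\<rho> \<le> 1"
  defines "g \<equiv> binomial_transform q"
  shows "upper_density {n. cmod (g n) < \<rho> ^ n \<and> cmod (g (Suc n) - g n) > 4 * \<rho> ^ n} \<le> 0"
proof (rule upper_density_nonpos[where c = 2])
  fix \<delta> :: real assume delta: "\<delta> > 0"
  define A where "A = {n. cmod (g n) < \<rho> ^ n \<and> cmod (g (Suc n) - g n) > 4 * \<rho> ^ n}"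
  define J where "J u = {n. \<bar>u n\<bar> < \<rho> ^ n \<and> \<bar>u (Suc n) - u n\<bar> > 2 * \<rho> ^ n}" for u :: "nat \<Rightarrow> real"
  define B C where "B = J (binomial_transform (\<lambda>k. Re (q k)))" and "C = J (binomial_transform (\<lambda>k. Im (q k)))"
  have Re: "Re (g n) = binomial_transform (\<lambda>k. Re (q k)) n"
    and Im: "Im (g n) = binomial_transform (\<lambda>k. Im (q k)) n" for n
    by (simp_all add: g_def binomial_transform_def)
  have "superexponential_decay (\<lambda>k. Re (q k))" "superexponential_decay (\<lambda>k. Im (q k))"
    using q unfolding superexponential_decay_def real_norm_def
    by (meson abs_Re_le_cmod abs_Im_le_cmod order_trans)+
  then have ev: "\<forall>\<^sub>F N in sequentially. real (card {m \<in> B. m \<le> N}) \<le> (\<delta> / 2) * real N + 1"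
      "\<forall>\<^sub>F N in sequentially. real (card {m \<in> C. m \<le> N}) \<le> (\<delta> / 2) * real N + 1"
    unfolding B_def C_def J_def
    using binomial_transform_rare_jumps[OF _ rho half_gt_zero[OF delta]] by blast+
  have sub: "A \<subseteq> B \<union> C"
  proof
    fix n assume "n \<in> A"
    then have n: "cmod (g n) < \<rho> ^ n" "cmod (g (Suc n) - g n) > 4 * \<rho> ^ n" by (auto simp: A_def)
    have "cmod (g (Suc n) - g n) \<le> \<bar>Re (g (Suc n) - g n)\<bar> + \<bar>Im (g (Suc n) - g n)\<bar>"
      by (rule cmod_le)
    then have "\<bar>Re (g (Suc n)) - Re (g n)\<bar> > 2 * \<rho> ^ n \<or> \<bar>Im (g (Suc n)) - Im (g n)\<bar> > 2 * \<rho> ^ n"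
      using n(2) by auto
    moreover have "\<bar>Re (g n)\<bar> < \<rho> ^ n" "\<bar>Im (g n)\<bar> < \<rho> ^ n"
      using n(1) abs_Re_le_cmod[of "g n"] abs_Im_le_cmod[of "g n"] by linarith+
    ultimately show "n \<in> B \<union> C"
      by (auto simp: B_def C_def J_def Re[symmetric] Im[symmetric])
  qed
  show "\<forall>\<^sub>F N in sequentially. real (card {m \<in> A. m \<le> N}) \<le> \<delta> * real N + 2"
    using ev
  proof eventually_elim
    case (elim N)
    have "{m \<in> A. m \<le> N} \<subseteq> {m \<in> B. m \<le> N} \<union> {m \<in> C. m \<le> N}" using sub by blast
    then have "card {m \<in> A. m \<le> N} \<le> card ({m \<in> B. m \<le> N} \<union> {m \<in> C. m \<le> N})"
      by (intro card_mono) auto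
    also have "\<dots> \<le> card {m \<in> B. m \<le> N} + card {m \<in> C. m \<le> N}" by (rule card_Un_le)
    finally show ?case using elim by linarith
  qed
qed

text \<open>Let \<open>f\<close> be a non-zero functional and consider its values along the orbit. For \<open>\<bar>\<alpha>\<bar> < 1\<close> they tend to \<open>0\<close>.
For \<open>\<bar>\<alpha>\<bar> \<ge> 1\<close> they are, up to the factors \<open>\<alpha>\<^sup>n\<close>, the binomial transform of the rapidly decaying sequence
\<open>f (Q\<^sup>k x)\<close> with \<open>T = \<alpha> (1 + Q)\<close>, and the visits to \<open>U\<close> are large jumps of it.\<close>

lemma singleton_spectrum_not_u_frequently_hypercyclic:
  fixes T :: "'a::complex_banach \<Rightarrow> 'a"
  assumes T: "bounded_clinear T" and spec: "spectrum T \<subseteq> {\<alpha>}"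
    and nontrivial: "\<exists>v :: 'a. v \<noteq> 0"
    and no: "no_dual_eigenvector T"
  shows "\<not> u_frequently_hypercyclic T"
proof
  assume "u_frequently_hypercyclic T"
  then obtain x where x: "\<And>U. open U \<Longrightarrow> U \<noteq> {} \<Longrightarrow> upper_density {n. n > 0 \<and> (T ^^ n) x \<in> U} > 0"
    unfolding u_frequently_hypercyclic_def by blast
  obtain v :: 'a where v: "v \<noteq> 0" using nontrivial by blast
  obtain f :: "'a \<Rightarrow> complex" where f: "bounded_clinear f" "f v = of_real (norm v)"
    using norming_functional[of v] by metis
  then have fv: "f v \<noteq> 0" using v by simp
  show False
  proof (cases "cmod \<alpha> < 1")
    case True
    \<comment> \<open>This radius lies strictly between \<open>1\<close> and \<open>1 / \<bar>\<alpha>\<bar>\<close>, so the series may be evaluated at \<open>1\<close>.\<close>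
    define r where "r = 2 / (1 + cmod \<alpha>)"
    have pos: "1 + cmod \<alpha> > 0" by (simp add: add_pos_nonneg)
    have inv: "has_bounded_inverse (\<lambda>x. x - u *\<^sub>C T x)" if "cmod u < r" for u
    proof -
      have "u = 0 \<or> 0 + 1 / u \<notin> spectrum T"
      proof (rule ccontr)
        assume "\<not> ?thesis"
        then have u: "u \<noteq> 0" "1 / u = \<alpha>" using spec by auto
        then have "cmod u * cmod \<alpha> = 1" by (metis nonzero_eq_divide_eq norm_mult norm_one mult.commute)
        moreover have "cmod u * (1 + cmod \<alpha>) < 2"
          using that pos by (simp add: r_def field_simps)
        ultimately have "cmod u < 1" by (simp add: algebra_simps)
        then have "cmod u * cmod \<alpha> < 1" using True by (metis mult_strict_mono' norm_ge_zero mult_1)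
        then show False using \<open>cmod u * cmod \<alpha> = 1\<close> by simp
      qed
      then show ?thesis
        using has_bounded_inverse_if_not_in_spectrum[of u 0 T] by simp
    qed
    have "summable (\<lambda>n. f ((T ^^ n) x) * 1 ^ n)"
      by (rule orbit_power_series[OF T f(1) inv, where r = r])
        (use True pos in \<open>simp_all add: r_def field_simps\<close>)
    then have "(\<lambda>n. f ((T ^^ n) x)) \<longlonglongrightarrow> 0"
      using summable_LIMSEQ_zero by (simp only: power_one mult_1_right)
    then have "Bseq (\<lambda>n. f ((T ^^ n) x))"
      by (intro convergent_imp_Bseq convergentI)
    then obtain B where B: "B > 0" "\<And>n. cmod (f ((T ^^ n) x)) \<le> B"
      unfolding Bseq_def by blast
    obtain u where u: "f u = of_real (B + 1)"
      using nonzero_functional_onto[OF f(1) fv] by metis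
    have "cmod (f u) = B + 1" unfolding u norm_of_real using B(1) by simp
    then have "u \<in> {u. B < cmod (f u)}" by simp
    then obtain n where "B < cmod (f ((T ^^ n) x))"
      using positive_upper_density_nonempty[OF x[OF open_norm_functional(1)[OF f(1), of B]]] by blast
    then show False using B(2)[of n] by simp
  next
    case False
    then have a0: "\<alpha> \<noteq> 0" by auto
    define \<rho> where "\<rho> = 1 / cmod \<alpha>"
    have rho: "0 < \<rho>" "\<rho> \<le> 1" using False a0 by (simp_all add: \<rho>_def)
    define P where "P y = (1 / \<alpha>) *\<^sub>C T y" for y
    define Q where "Q y = (1 / \<alpha>) *\<^sub>C (T y - \<alpha> *\<^sub>C y)" for y
    have P: "bounded_clinear P" unfolding P_def by (rule bounded_clinear_mult_scaleC[OF T])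
    have Q: "bounded_clinear Q"
      unfolding Q_def by (intro bounded_clinear_mult_scaleC bounded_clinear_sub_scaleC T)
    have PQ: "P y = y + Q y" for y
      using a0 by (simp add: P_def Q_def complex_vector.scale_right_diff_distrib scaleC_scaleC scaleC_one)
    have P_pow: "(P ^^ n) y = (1 / \<alpha>) ^ n *\<^sub>C (T ^^ n) y" for n y
      by (induction n) (simp_all add: P_def bounded_clinear_scaleC[OF T] scaleC_scaleC scaleC_one)
    define q where "q k = f ((Q ^^ k) x)" for k
    define g where "g = binomial_transform q"
    have g: "g n = (1 / \<alpha>) ^ n * f ((T ^^ n) x)" for n
      using funpow_binomial_transform[OF P f(1) PQ, of n x, folded q_def]
      by (simp add: P_pow g_def q_def[abs_def] bounded_clinear_scaleC[OF f(1)] scaleC_complex_def)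
    have "superexponential_decay q"
    proof (rule superexponential_decay_if_entire)
      fix w :: complex
      have inv: "has_bounded_inverse (\<lambda>y. y - u *\<^sub>C Q y)" for u
      proof -
        have "u / \<alpha> = 0 \<or> \<alpha> + 1 / (u / \<alpha>) \<notin> spectrum T"
          using spec a0 by auto
        then show ?thesis
          using has_bounded_inverse_if_not_in_spectrum[of "u / \<alpha>" \<alpha> T]
          by (simp add: Q_def scaleC_scaleC)
      qed
      show "summable (\<lambda>n. q n * w ^ n)"
        unfolding q_def by (rule orbit_power_series[OF Q f(1) inv, where r = "cmod w + 1"]) simp
    qed
    then have rare: "upper_density {n. cmod (g n) < \<rho> ^ n \<and> cmod (g (Suc n) - g n) > 4 * \<rho> ^ n} \<le> 0"
      unfolding g_def by (rule complex_binomial_transform_rare_jumps[OF _ rho])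
    define h where "h u = f (T u) / \<alpha> - f u" for u
    have h: "bounded_clinear h"
    proof -
      have eq: "h = (\<lambda>u. f (Q u))"
        using a0 by (auto simp: h_def Q_def bounded_clinear_scaleC[OF f(1)] bounded_clinear_diff[OF f(1)]
            scaleC_complex_def field_simps)
      show ?thesis unfolding eq by (rule bounded_clinear_compose[OF f(1) Q])
    qed
    define U where "U = {u. cmod (f u) < 1} \<inter> {u. 4 < cmod (h u)}"
    have "open U"
      unfolding U_def by (intro open_Int open_norm_functional f(1) h)
    moreover have "U \<noteq> {}"
    proof -
      \<comment> \<open>If the kernel of \<open>f\<close> were invariant under \<open>T\<close>, then \<open>f\<close> would be an eigenvector of the dual.\<close>
      have "\<exists>w. f w = 0 \<and> f (T w) \<noteq> 0"
      proof (rule ccontr)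
        assume none: "\<nexists>w. f w = 0 \<and> f (T w) \<noteq> 0"
        obtain e where e: "f e = 1" using nonzero_functional_onto[OF f(1) fv] by metis
        have "f (T y) = f (T e) * f y" for y
        proof -
          have "f (y - f y *\<^sub>C e) = 0"
            by (simp add: bounded_clinear_diff[OF f(1)] bounded_clinear_scaleC[OF f(1)] e scaleC_complex_def)
          then have "f (T (y - f y *\<^sub>C e)) = 0" using none by blast
          then show ?thesis
            by (simp add: bounded_clinear_diff[OF f(1)] bounded_clinear_scaleC[OF f(1)]
                bounded_clinear_diff[OF T] bounded_clinear_scaleC[OF T] scaleC_complex_def mult.commute)
        qed
        then show False using no f(1) fv unfolding no_dual_eigenvector_def by blast
      qed
      then obtain w where w: "f w = 0" "f (T w) \<noteq> 0" by blast
      define u where "u = (5 * \<alpha> / f (T w)) *\<^sub>C w"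
      have "f u = 0" "h u = 5"
        using w a0 by (simp_all add: u_def h_def bounded_clinear_scaleC[OF f(1)]
            bounded_clinear_scaleC[OF T] scaleC_complex_def)
      then have "u \<in> U" by (simp add: U_def)
      then show ?thesis by blast
    qed
    ultimately have "upper_density {n. n > 0 \<and> (T ^^ n) x \<in> U} > 0" by (rule x)
    moreover have "upper_density {n. n > 0 \<and> (T ^^ n) x \<in> U} \<le>
        upper_density {n. cmod (g n) < \<rho> ^ n \<and> cmod (g (Suc n) - g n) > 4 * \<rho> ^ n}"
      unfolding upper_density_def
    proof (intro Limsup_mono always_eventually allI ereal_less_eq(3)[THEN iffD2] divide_right_mono
        of_nat_mono card_mono)
      fix N
      have "cmod (g n) < \<rho> ^ n \<and> cmod (g (Suc n) - g n) > 4 * \<rho> ^ n" if "(T ^^ n) x \<in> U" for n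
      proof -
        have norm_pow: "cmod ((1 / \<alpha>) ^ n) = \<rho> ^ n"
          by (simp add: \<rho>_def norm_power norm_divide)
        have pos: "\<rho> ^ n > 0" using rho by simp
        have "g (Suc n) - g n = (1 / \<alpha>) ^ n * h ((T ^^ n) x)"
          by (simp add: g h_def algebra_simps)
        then have "cmod (g (Suc n) - g n) = \<rho> ^ n * cmod (h ((T ^^ n) x))"
          by (simp only: norm_mult norm_pow)
        moreover have "cmod (g n) = \<rho> ^ n * cmod (f ((T ^^ n) x))"
          by (simp only: g norm_mult norm_pow)
        ultimately show ?thesis
          using that pos by (simp add: U_def)
      qed
      then show "{m \<in> {n. n > 0 \<and> (T ^^ n) x \<in> U}. m \<le> N} \<subseteq>
          {m \<in> {n. cmod (g n) < \<rho> ^ n \<and> cmod (g (Suc n) - g n) > 4 * \<rho> ^ n}. m \<le> N}"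
        by blast
    qed simp_all
    ultimately show False using rare by simp
  qed
qed

theorem corollary1p4:
  assumes "separable_space (euclidean :: 'a::complex_banach topology)"
    and "hereditarily_indecomposable TYPE('a)"
  shows "(\<nexists>T :: 'a \<Rightarrow> 'a. bounded_clinear T \<and> u_frequently_hypercyclic T) \<and>
         (\<nexists>T :: 'a \<Rightarrow> 'a. bounded_clinear T \<and> frequently_hypercyclic T)"
proof -
  have "\<not> u_frequently_hypercyclic T" if T: "bounded_clinear T" for T :: "'a \<Rightarrow> 'a"
  proof
    assume u: "u_frequently_hypercyclic T"
    then obtain x where x: "\<And>U. open U \<Longrightarrow> U \<noteq> {} \<Longrightarrow> upper_density {n. n > 0 \<and> (T ^^ n) x \<in> U} > 0"
      unfolding u_frequently_hypercyclic_def by blast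
    have no: "no_dual_eigenvector T"
    proof (rule dense_orbit_no_dual_eigenvector)
      show "\<exists>n. (T ^^ n) x \<in> U" if "open U" "U \<noteq> {}" for U
        using positive_upper_density_nonempty[OF x[OF that]] by blast
    qed
    obtain \<alpha> where "spectrum T \<subseteq> {\<alpha>}"
      using hereditarily_indecomposable_spectrum[OF assms(2) T no] by blast
    moreover have "\<exists>v :: 'a. v \<noteq> 0"
    proof (rule ccontr)
      assume "\<nexists>v :: 'a. v \<noteq> 0"
      then have "complex_vector.span {} = (UNIV :: 'a set)" by auto
      then show False
        using assms(2) unfolding hereditarily_indecomposable_def infinite_dimensional_def by blast
    qed
    ultimately show False
      using singleton_spectrum_not_u_frequently_hypercyclic[OF T _ _ no] u by blast
  qed
  then show ?thesis
    using frequently_imp_u_frequently_hypercyclic by blast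
qed

end
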